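(* For (Lebesgue) almost every $\alpha$ with $0<\alpha<1$, the $\alpha$-continued fraction map $G_\alpha$ is not $\phi$-mixing.
   Context: For $0<\alpha<1$ let $\mathbb I_\alpha=[\alpha-1,\alpha)$; $G_\alpha:\mathbb I_\alpha\to\mathbb I_\alpha$ is $G_\alpha(0)=0$ and $G_\alpha(x)=\frac1{|x|}-\left\lfloor\frac1{|x|}+1-\alpha\right\rfloor$ for $x\ne0$. Put $\varepsilon_{\alpha,n}(x)=\operatorname{sgn}(G_\alpha^{n-1}(x))$ and $a_{\alpha,n}(x)=\left\lfloor\frac1{|G_\alpha^{n-1}(x)|}+1-\alpha\right\rfloor$, $n\ge1$ (defined for irrational $x$). Let $\mu_\alpha$ be the absolutely continuous $G_\alpha$-invariant probability measure; under $\mu_\alpha$ the sequence $(a_{\alpha,n},\varepsilon_{\alpha,n})_{n\ge1}$ is a stationary process. For a probability space $(\Omega,\mathfrak B,P)$ and sub-$\sigma$-algebras $\mathcal A,\mathcal B\subset\mathfrak B$ put $$\phi(\mathcal A,\mathcal B)=\sup\left\{\left|\frac{P(A\cap B)}{P(A)}-P(B)\right|:A\in\mathcal A,\ B\in\mathcal B,\ P(A)>0\right\}.$$ For a stationary sequence $(X_n)_{n\ge1}$ let $\mathcal F_m^n$ be the $\sigma$-algebra generated by $X_m,\dots,X_n$ (and $\mathcal F_m^\infty$ that generated by $X_m,X_{m+1},\dots$), and $\phi(n)=\sup_{m\ge1}\phi(\mathcal F_1^m,\mathcal F_{m+n}^\infty)$. The process is $\phi$-mixing if $\lim_{n\to\infty}\phi(n)=0$.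 The map $G_\alpha$ is called $\phi$-mixing if the process $(a_{\alpha,n},\varepsilon_{\alpha,n})_{n\ge1}$ is $\phi$-mixing (under $\mu_\alpha$). *)

theory Defs
  imports "HOL-Probability.Probability"
begin

definition phi_dep :: "'a measure \<Rightarrow> 'a set set \<Rightarrow> 'a set set \<Rightarrow> real" where
  "phi_dep P \<A> \<B> =
     Sup {\<bar>measure P (A \<inter> B) / measure P A - measure P B\<bar> | A B.
            A \<in> \<A> \<and> B \<in> \<B> \<and> measure P A > 0}"

definition gen_sigma :: "'a measure \<Rightarrow> 'b measure \<Rightarrow> (nat \<Rightarrow> 'a \<Rightarrow> 'b) \<Rightarrow> nat set \<Rightarrow> 'a set set" where
  "gen_sigma P N X I = sigma_sets (space P) {X i -` S \<inter> space P | i S. i \<in> I \<and> S \<in> sets N}"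

text \<open>Sequences are indexed by the positive integers; \<open>X 0\<close> is never used.\<close>

definition phi_coeff :: "'a measure \<Rightarrow> 'b measure \<Rightarrow> (nat \<Rightarrow> 'a \<Rightarrow> 'b) \<Rightarrow> nat \<Rightarrow> real" where
  "phi_coeff P N X n = (SUP m\<in>{1..}. phi_dep P (gen_sigma P N X {1..m}) (gen_sigma P N X {m+n..}))"

definition phi_mixing :: "'a measure \<Rightarrow> 'b measure \<Rightarrow> (nat \<Rightarrow> 'a \<Rightarrow> 'b) \<Rightarrow> bool" where
  "phi_mixing P N X \<longleftrightarrow> phi_coeff P N X \<longlonglongrightarrow> 0"

text \<open>
  On a probability space both suprema are taken over nonempty sets of numbers in \<open>[0, 1]\<close>, so that
  the conditionally complete supremum of the reals is the intended one.
\<close>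

lemma (in prob_space) phi_dep_set_bounds:
  assumes "\<A> \<subseteq> events" "\<B> \<subseteq> events"
    and "x \<in> {\<bar>prob (A \<inter> B) / prob A - prob B\<bar> | A B. A \<in> \<A> \<and> B \<in> \<B> \<and> prob A > 0}"
  shows "0 \<le> x" "x \<le> 1"
proof -
  obtain A B where AB: "A \<in> \<A>" "B \<in> \<B>" "prob A > 0"
    and x: "x = \<bar>prob (A \<inter> B) / prob A - prob B\<bar>"
    using assms(3) by blast
  have "A \<in> events" "B \<in> events" using AB assms by auto
  then have "prob (A \<inter> B) \<le> prob A" by (intro finite_measure_mono) auto
  then have "prob (A \<inter> B) / prob A \<le> 1" using AB(3) by simp
  moreover have "0 \<le> prob (A \<inter> B) / prob A" by simp
  moreover have "0 \<le> prob B" "prob B \<le> 1" by simp_all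
  ultimately show "0 \<le> x" "x \<le> 1" unfolding x by linarith+
qed

definition cf_interval :: "real \<Rightarrow> real set" where
  "cf_interval \<alpha> = {\<alpha> - 1..<\<alpha>}"

definition cf_map :: "real \<Rightarrow> real \<Rightarrow> real" where
  "cf_map \<alpha> x = (if x = 0 then 0 else 1 / \<bar>x\<bar> - of_int \<lfloor>1 / \<bar>x\<bar> + 1 - \<alpha>\<rfloor>)"

text \<open>
  The digits are only meaningful at irrational points. The rationals form a countable set, hence a
  null set for every absolutely continuous measure, so the values given to the digits there (via
  \<open>1 / 0 = 0\<close>) do not affect any probability.
\<close>

definition cf_eps :: "real \<Rightarrow> nat \<Rightarrow> real \<Rightarrow> real" where
  "cf_eps \<alpha> n x = sgn ((cf_map \<alpha> ^^ (n - 1)) x)"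

definition cf_dig :: "real \<Rightarrow> nat \<Rightarrow> real \<Rightarrow> int" where
  "cf_dig \<alpha> n x = \<lfloor>1 / \<bar>(cf_map \<alpha> ^^ (n - 1)) x\<bar> + 1 - \<alpha>\<rfloor>"

definition cf_process :: "real \<Rightarrow> nat \<Rightarrow> real \<Rightarrow> int \<times> real" where
  "cf_process \<alpha> n x = (cf_dig \<alpha> n x, cf_eps \<alpha> n x)"

definition cf_acip :: "real \<Rightarrow> real measure \<Rightarrow> bool" where
  "cf_acip \<alpha> \<mu> \<longleftrightarrow>
     prob_space \<mu> \<and>
     sets \<mu> = sets (restrict_space lborel (cf_interval \<alpha>)) \<and>
     absolutely_continuous (restrict_space lborel (cf_interval \<alpha>)) \<mu> \<and>
     cf_map \<alpha> \<in> \<mu> \<rightarrow>\<^sub>M \<mu> \<and> distr \<mu> \<mu> (cf_map \<alpha>) = \<mu>"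

definition cf_phi_mixing :: "real \<Rightarrow> real measure \<Rightarrow> bool" where
  "cf_phi_mixing \<alpha> \<mu> \<longleftrightarrow> phi_mixing \<mu> (count_space UNIV \<Otimes>\<^sub>M borel) (cf_process \<alpha>)"

lemma cf_map_in_cf_interval:
  assumes "0 < \<alpha>" "\<alpha> < 1"
  shows "cf_map \<alpha> x \<in> cf_interval \<alpha>"
  using assms unfolding cf_map_def cf_interval_def by (auto, linarith+)

lemma cf_map_measurable:
  assumes "0 < \<alpha>" "\<alpha> < 1" "sets \<mu> = sets (restrict_space lborel (cf_interval \<alpha>))"
  shows "cf_map \<alpha> \<in> \<mu> \<rightarrow>\<^sub>M \<mu>"
proof -
  have "cf_map \<alpha> \<in> borel \<rightarrow>\<^sub>M borel"
    unfolding cf_map_def[abs_def] by measurable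
  then have "cf_map \<alpha> \<in> restrict_space lborel (cf_interval \<alpha>) \<rightarrow>\<^sub>M
      restrict_space lborel (cf_interval \<alpha>)"
    using cf_map_in_cf_interval[OF assms(1,2)]
    by (intro measurable_restrict_space3) auto
  then show ?thesis
    using measurable_cong_sets[OF assms(3) assms(3)] by blast
qed

end

theory Submission
  imports Defs
begin

text \<open>
  Suppose the orbit of \<open>\<alpha> - 1\<close> under \<open>G\<close> returns arbitrarily close to \<open>\<alpha> - 1\<close>, at times \<open>m\<close> at which \<open>G\<^sup>m\<close> is
  decreasing. Then \<open>G\<^sup>m\<close> maps the set \<open>A\<close> of points sharing the first \<open>m\<close> digits of \<open>\<alpha> - 1\<close> into a short
  interval starting at \<open>\<alpha> - 1\<close>, on which arbitrarily many further digits are constant. So on \<open>A\<close> the digits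
  with indices \<open>m + n, \<dots>, m + n + L\<close> are prescribed, an event of probability less than \<open>1 / 2\<close> for large \<open>L\<close>,
  and \<open>\<phi>(n) \<ge> 1 / 2\<close> for every \<open>n\<close>.

  The returns come from the regular continued fraction of \<open>\<alpha>\<close> with its Gauss map \<open>T\<close>: whenever \<open>T\<^sup>k x < \<alpha>\<close> (with \<open>T\<^sup>k\<close>
  applied to the fractional part of \<open>x\<close>) some \<open>G\<close>-iterate of \<open>x\<close> differs from \<open>T\<^sup>k\<^sup>+\<^sup>1 x\<close> by an integer and has
  the monotonicity of \<open>T\<^sup>k\<^sup>+\<^sup>1\<close>, and almost every point visits all cylinders of even length under \<open>T\<^sup>2\<close>.
  Applied to almost every point of the interval, this also shows that \<open>A\<close> has positive measure, without any
  knowledge of the density of \<open>\<mu>\<close>.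
\<close>

section \<open>Recurrence of the Gauss map\<close>

definition gauss_map :: "real \<Rightarrow> real" where
  "gauss_map x = frac (1 / x)"

fun gauss_cylinder :: "nat list \<Rightarrow> real set" where
  "gauss_cylinder [] = UNIV"
| "gauss_cylinder (a # w) = {x. 0 < x \<and> \<lfloor>1 / x\<rfloor> = int a \<and> gauss_map x \<in> gauss_cylinder w}"

lemma gauss_map_measurable [measurable]: "gauss_map \<in> borel \<rightarrow>\<^sub>M borel"
  unfolding gauss_map_def[abs_def] frac_def by measurable

lemma gauss_cylinder_measurable [measurable]: "gauss_cylinder w \<in> sets borel"
  by (induction w) auto

text \<open>Conditioning one of these densities on the first digit and applying the Gauss map gives another one,
  so they serve as a substitute for bounded distortion.\<close>

definition mobius_density :: "real \<Rightarrow> real \<Rightarrow> real" where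
  "mobius_density s t = (1 + s) / (1 + s * t)\<^sup>2 * indicator {0..1} t"

definition mobius_measure :: "real \<Rightarrow> real measure" where
  "mobius_measure s = density lborel (\<lambda>t. ennreal (mobius_density s t))"

lemma mobius_density_measurable [measurable]: "mobius_density s \<in> borel \<rightarrow>\<^sub>M borel"
  unfolding mobius_density_def[abs_def] by measurable

lemma sets_mobius_measure [simp, measurable_cong]: "sets (mobius_measure s) = sets borel"
  by (simp add: mobius_measure_def)

lemma space_mobius_measure [simp]: "space (mobius_measure s) = UNIV"
  by (simp add: mobius_measure_def)

lemma emeasure_mobius:
  assumes [measurable]: "E \<in> sets borel"
  shows "emeasure (mobius_measure s) E = (\<integral>\<^sup>+ t. ennreal (mobius_density s t * indicator E t) \<partial>lborel)"
  unfolding mobius_measure_def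
  by (subst emeasure_density) (auto intro!: nn_integral_cong split: split_indicator)

lemma prob_space_mobius_measure:
  assumes "0 \<le> s"
  shows "prob_space (mobius_measure s)"
proof
  have "((\<lambda>t. (1 + s) * t / (1 + s * t)) has_real_derivative (1 + s) / (1 + s * t)\<^sup>2) (at t)"
    if "0 \<le> t" for t
  proof -
    have "1 + s * t \<noteq> 0" using that assms by (smt (verit) mult_nonneg_nonneg)
    then show ?thesis
      by (auto intro!: derivative_eq_intros simp: field_simps power2_eq_square)
  qed
  then have "(\<integral>\<^sup>+ t. ennreal ((1 + s) / (1 + s * t)\<^sup>2) * indicator {0..1} t \<partial>lborel)
      = ennreal ((1 + s) * 1 / (1 + s * 1) - (1 + s) * 0 / (1 + s * 0))"
    by (intro nn_integral_FTC_Icc) (use assms in auto)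
  then show "emeasure (mobius_measure s) (space (mobius_measure s)) = 1"
    using assms by (simp add: emeasure_mobius mobius_density_def nn_integral_set_ennreal)
qed

text \<open>The density is at least \<open>1 / 2\<close> on the unit interval, because
  \<open>(1 + s * t)^2 \<le> (1 + s)^2 \<le> 2 * (1 + s)\<close>. This will bound the probability of
  a digit from below, uniformly in \<open>s\<close>.\<close>

lemma mobius_measure_ge_lborel:
  assumes "0 \<le> s" "s \<le> 1" and [measurable]: "E \<in> sets borel" and "E \<subseteq> {0..1}"
  shows "emeasure lborel E \<le> 2 * emeasure (mobius_measure s) E"
proof -
  have "ennreal (indicator E t) \<le> 2 * ennreal (mobius_density s t * indicator E t)" for t
  proof (cases "t \<in> E")
    case True
    then have t: "0 \<le> t" "t \<le> 1" using assms by auto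
    have "(1 + s * t)\<^sup>2 \<le> (1 + s)\<^sup>2" 
      using t assms(1) by (intro power_mono) (auto simp: mult_left_le)
    also have "\<dots> \<le> 2 * (1 + s)" 
      using assms(1,2) mult_right_mono[of "1 + s" 2 "1 + s"] by (simp add: power2_eq_square)
    finally have "1 \<le> 2 * ((1 + s) / (1 + s * t)\<^sup>2)"
      using t assms(1) by (simp add: field_simps add_nonneg_eq_0_iff)
    then have "ennreal 1 \<le> ennreal (2 * ((1 + s) / (1 + s * t)\<^sup>2))" by (rule ennreal_leI)
    also have "\<dots> = 2 * ennreal ((1 + s) / (1 + s * t)\<^sup>2)"
      using assms(1) by (subst ennreal_mult) auto
    finally show ?thesis
      using True t by (simp add: mobius_density_def)
  qed simp
  then have "(\<integral>\<^sup>+ t. ennreal (indicator E t) \<partial>lborel)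
     \<le> (\<integral>\<^sup>+ t. 2 * ennreal (mobius_density s t * indicator E t) \<partial>lborel)"
    by (intro nn_integral_mono)
  then show ?thesis
    by (simp add: emeasure_mobius nn_integral_cmult ennreal_indicator)
qed

lemma AE_mobius_imp_AE_lborel:
  assumes "0 \<le> s" "s \<le> 1" "AE x in mobius_measure s. P x"
  shows "AE x in lborel. 0 \<le> x \<and> x \<le> 1 \<longrightarrow> P x"
proof -
  have "AE x in lborel. 0 < ennreal (mobius_density s x) \<longrightarrow> P x"
    using assms(3) unfolding mobius_measure_def by (subst (asm) AE_density) auto
  then show ?thesis
  proof eventually_elim
    case (elim x)
    have "1 + s * x \<noteq> 0" if "0 \<le> x" using assms(1) that by (smt (verit) mult_nonneg_nonneg)
    then show ?case using elim assms by (auto simp: mobius_density_def)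
  qed
qed

text \<open>The substitution \<open>x = 1 / (a + t)\<close> turns the density into
  \<open>(1 + s) / (a + s + t)^2\<close>, which is proportional to the density with parameter
  \<open>1 / (a + s)\<close>.\<close>

lemma gauss_digit_mobius:
  fixes a :: nat and s :: real
  assumes "0 \<le> s" "a > 0" and [measurable]: "E \<in> sets borel"
  shows "emeasure (mobius_measure s) {x. 0 < x \<and> \<lfloor>1 / x\<rfloor> = int a \<and> gauss_map x \<in> E}
     = emeasure (mobius_measure s) {x. 0 < x \<and> \<lfloor>1 / x\<rfloor> = int a} * emeasure (mobius_measure (1 / (a + s))) E"
proof -
  define s' where "s' = 1 / (a + s)"
  \<comment> \<open>The ratio of \<open>(1 + s) / (a + s + t)^2\<close> to the density with
    parameter \<open>s'\<close>; the case \<open>F = UNIV\<close> below identifies it as the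
    probability of the digit \<open>a\<close>.\<close>
  define c where "c = (1 + s) / ((a + s)\<^sup>2 * (1 + s'))"
  have as: "0 < a + s" using assms by linarith
  have s': "0 < s'" unfolding s'_def using as by simp
  have c: "0 \<le> c" unfolding c_def using s' assms by simp
  have main: "emeasure (mobius_measure s) {x. 0 < x \<and> \<lfloor>1 / x\<rfloor> = int a \<and> gauss_map x \<in> F}
     = ennreal c * emeasure (mobius_measure s') F" if [measurable]: "F \<in> sets borel" for F
  proof -
    define f where "f x = mobius_density s x * indicator F (gauss_map x)" for x
    have [measurable]: "f \<in> borel \<rightarrow>\<^sub>M borel" unfolding f_def[abs_def] by measurable
    \<comment> \<open>The variable \<open>u = - t\<close> makes the substitution increasing.\<close>
    let ?g = "\<lambda>u::real. 1 / (real a - u)"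
    have dig: "\<lfloor>1 / x\<rfloor> = int a \<longleftrightarrow> 1 / (a + 1) < x \<and> x \<le> 1 / a" if "0 < x" for x
      using that assms by (auto simp: floor_eq_iff field_simps)
    have "emeasure (mobius_measure s) {x. 0 < x \<and> \<lfloor>1 / x\<rfloor> = int a \<and> gauss_map x \<in> F}
       = (\<integral>\<^sup>+ x. ennreal (mobius_density s x * indicator {x. 0 < x \<and> \<lfloor>1 / x\<rfloor> = int a \<and> gauss_map x \<in> F} x) \<partial>lborel)"
      by (rule emeasure_mobius) measurable
    also have "\<dots> = (\<integral>\<^sup>+ x. f x * indicator {?g (-1)..?g 0} x \<partial>lborel)"
    \<comment> \<open>The digit cell is half-open; the endpoint added here is a null set.\<close>
    proof (rule nn_integral_cong_AE, use AE_lborel_singleton[of "1 / (a + 1)"] in eventually_elim)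
      case (elim x)
      have "0 < 1 / (real a + 1)" by simp
      then have "(0 < x \<and> \<lfloor>1 / x\<rfloor> = int a) \<longleftrightarrow> x \<in> {1 / (real a + 1) .. 1 / a}"
        using elim dig[of x] by (smt (verit) atLeastAtMost_iff of_nat_1 of_nat_add)
      then show ?case by (auto simp: f_def add.commute split: split_indicator)
    qed
    also have "\<dots> = (\<integral>\<^sup>+ u. f (?g u) * (1 / (a - u)\<^sup>2) * indicator {-1..0} u \<partial>lborel)"
    proof (rule nn_integral_substitution[where g = ?g and f = f and g' = "\<lambda>u. 1 / (real a - u)\<^sup>2"])
      show "set_borel_measurable borel {?g (-1)..?g 0} f"
        unfolding set_borel_measurable_def by measurable
      show "(?g has_real_derivative 1 / (real a - u)\<^sup>2) (at u)" if "u \<in> {-1..0}" for u :: real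
        using that assms(2) by (auto intro!: derivative_eq_intros simp: power2_eq_square)
      show "continuous_on {-1..0} (\<lambda>u. 1 / (real a - u)\<^sup>2)"
        using assms(2) by (auto intro!: continuous_intros)
    qed auto
    also have "\<dots> = (\<integral>\<^sup>+ t. f (1 / (a + t)) * (1 / (a + t)\<^sup>2) * indicator {0..1} t \<partial>lborel)"
      by (subst nn_integral_real_affine[where c = "-1" and t = 0])
         (auto intro!: nn_integral_cong split: split_indicator)
    also have "\<dots> = (\<integral>\<^sup>+ t. ennreal c * ennreal (mobius_density s' t * indicator F t) \<partial>lborel)"
    \<comment> \<open>At \<open>t = 1\<close> the Gauss map sends \<open>1 / (a + t)\<close> to 0
      instead of \<open>t\<close>.\<close>
    proof (rule nn_integral_cong_AE, use AE_lborel_singleton[of 1] in eventually_elim)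
      case (elim t)
      show ?case
      proof (cases "t \<in> {0..<1}")
        case True
        then have t: "0 \<le> t" "t < 1" by auto
        have at: "a + t > 0" "a + t \<ge> 1" and ast: "a + s + t > 0" using assms t by linarith+
        have T: "gauss_map (1 / (a + t)) = t"
          unfolding gauss_map_def using t by (simp add: frac_unique_iff)
        have "(1 + s) / (1 + s * (1 / (a + t)))\<^sup>2 * (1 / (a + t)\<^sup>2) = (1 + s) / (a + s + t)\<^sup>2"
        proof -
          have "1 + s * (1 / (a + t)) = (a + s + t) / (a + t)" using at by (simp add: field_simps)
          then show ?thesis using at ast by (simp add: power_divide)
        qed
        moreover have "c * ((1 + s') / (1 + s' * t)\<^sup>2) = (1 + s) / (a + s + t)\<^sup>2"
        proof -
          have "1 + s' * t = (a + s + t) / (a + s)" using as by (simp add: s'_def field_simps)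
          moreover have "c * (1 + s') = (1 + s) / (a + s)\<^sup>2" using s' by (simp add: c_def)
          moreover have "c * ((1 + s') / (1 + s' * t)\<^sup>2) = (c * (1 + s')) / (1 + s' * t)\<^sup>2" by simp
          ultimately have "c * ((1 + s') / (1 + s' * t)\<^sup>2)
              = (1 + s) / (real a + s)\<^sup>2 / ((real a + s + t) / (real a + s))\<^sup>2"
            by (simp only:)
          then show ?thesis using as by (simp add: power_divide)
        qed
        ultimately have eq: "(1 + s) / (1 + s * (1 / (a + t)))\<^sup>2 * (1 / (a + t)\<^sup>2)
          = c * ((1 + s') / (1 + s' * t)\<^sup>2)" by (simp only:)
        have "f (1 / (a + t)) = (1 + s) / (1 + s * (1 / (a + t)))\<^sup>2 * indicator F t"
          using at by (simp add: f_def T mobius_density_def)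
        then have "f (1 / (a + t)) * (1 / (a + t)\<^sup>2)
            = (1 + s) / (1 + s * (1 / (a + t)))\<^sup>2 * (1 / (a + t)\<^sup>2) * indicator F t"
          by (simp only: ac_simps)
        also have "\<dots> = c * (mobius_density s' t * indicator F t)"
          unfolding eq using t by (simp add: mobius_density_def)
        finally show ?thesis using t c by (simp add: ennreal_mult')
      next
        case False
        then show ?thesis using elim by (auto simp: mobius_density_def split: split_indicator)
      qed
    qed
    also have "\<dots> = ennreal c * emeasure (mobius_measure s') F"
      by (subst nn_integral_cmult) (auto simp: emeasure_mobius)
    finally show ?thesis .
  qed
  interpret prob_space "mobius_measure s'" by (rule prob_space_mobius_measure) (use s' in simp)
  have "emeasure (mobius_measure s) {x. 0 < x \<and> \<lfloor>1 / x\<rfloor> = int a} = ennreal c"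
    using main[of UNIV] emeasure_space_1 by simp
  then show ?thesis using main[of E] by (simp add: s'_def)
qed

text \<open>Summing \<open>gauss_digit_mobius\<close> over the digits in \<open>K\<close> gives
  this, since every parameter \<open>1 / (a + s)\<close> lies in the unit interval and \<kappa>
  bounds each term. The digit condition is an implication so that \<open>K = UNIV\<close> yields the
  whole line and \<open>K = - {a}\<close> the complement of a digit cell; points outside
  \<open>(0, 1]\<close> are null.\<close>

lemma emeasure_gauss_vimage_le:
  fixes s :: real and \<kappa> :: ennreal and K :: "nat set"
  assumes s: "0 \<le> s" and [measurable]: "E \<in> sets borel"
    and le: "\<And>s. 0 \<le> s \<Longrightarrow> s \<le> 1 \<Longrightarrow> emeasure (mobius_measure s) E \<le> \<kappa>"
  shows "emeasure (mobius_measure s) {x. (\<forall>a. 0 < x \<and> \<lfloor>1 / x\<rfloor> = int a \<longrightarrow> a \<in> K) \<and> gauss_map x \<in> E}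
    \<le> emeasure (mobius_measure s) {x. \<forall>a. 0 < x \<and> \<lfloor>1 / x\<rfloor> = int a \<longrightarrow> a \<in> K} * \<kappa>"
proof -
  let ?M = "mobius_measure s"
  let ?D = "\<lambda>a. {x::real. 0 < x \<and> \<lfloor>1 / x\<rfloor> = int a}"
  let ?I = "\<lambda>a. if a \<in> K \<and> 0 < a then ?D a else {}"
  have [measurable]: "?I a \<in> sets borel" for a by simp
  have disj: "disjoint_family ?I" "disjoint_family (\<lambda>a. ?I a \<inter> gauss_map -` E)"
    by (auto simp: disjoint_family_on_def)
  have AE: "AE x in ?M. 0 < x \<and> x \<le> 1"
    unfolding mobius_measure_def using AE_lborel_singleton[of 0]
    by (subst AE_density) (auto simp: mobius_density_def split: split_indicator)
  have dig: "\<exists>a>0. \<lfloor>1 / x\<rfloor> = int a" if "0 < x" "x \<le> 1" for x :: real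
  proof -
    have "1 \<le> \<lfloor>1 / x\<rfloor>" using that by (simp add: le_floor_iff)
    then show ?thesis by (intro exI[of _ "nat \<lfloor>1 / x\<rfloor>"]) auto
  qed
  have "emeasure ?M {x. (\<forall>a. 0 < x \<and> \<lfloor>1 / x\<rfloor> = int a \<longrightarrow> a \<in> K) \<and> gauss_map x \<in> E}
      = emeasure ?M (\<Union>a. ?I a \<inter> gauss_map -` E)"
    by (intro emeasure_eq_AE, use AE in eventually_elim)
       (use dig in \<open>fastforce split: if_splits\<close>, measurable)
  also have "\<dots> = (\<Sum>a. emeasure ?M (?I a \<inter> gauss_map -` E))"
    by (intro suminf_emeasure[symmetric] disj) (auto intro!: measurable_sets_borel[OF gauss_map_measurable])
  also have "\<dots> \<le> (\<Sum>a. emeasure ?M (?I a) * \<kappa>)"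
  proof (intro suminf_le allI)
    fix a
    show "emeasure ?M (?I a \<inter> gauss_map -` E) \<le> emeasure ?M (?I a) * \<kappa>"
    proof (cases "a \<in> K \<and> 0 < a")
      case True
      then have "emeasure ?M (?I a \<inter> gauss_map -` E) = emeasure ?M (?D a) * emeasure (mobius_measure (1 / (a + s))) E"
        using gauss_digit_mobius[OF s _ assms(2), of a]
        by (simp add: Int_def vimage_def conj_assoc)
      also have "\<dots> \<le> emeasure ?M (?D a) * \<kappa>"
        using True s by (intro mult_left_mono le) auto
      finally show ?thesis using True by simp
    qed auto
  qed auto
  also have "\<dots> = emeasure ?M (\<Union>a. ?I a) * \<kappa>"
    by (subst ennreal_suminf_multc, subst suminf_emeasure) (use disj in auto)
  also have "emeasure ?M (\<Union>a. ?I a) = emeasure ?M {x. \<forall>a. 0 < x \<and> \<lfloor>1 / x\<rfloor> = int a \<longrightarrow> a \<in> K}"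
    by (intro emeasure_eq_AE, use AE in eventually_elim)
       (use dig in \<open>fastforce split: if_splits\<close>, measurable)
  finally show ?thesis .
qed


text \<open>Missing \<open>w\<close> multiplies a bound that is uniform in \<open>s\<close> by a
  factor depending on \<open>w\<close> alone. If the first digit is wrong, only the bound
  \<open>k\<close> for the remaining steps is available, which is why the first inequality is
  carried along. If it is right, an event of probability bounded below, the induction hypothesis
  gains a factor on the tail.\<close>

lemma gauss_avoid_word:
  assumes "\<And>a. a \<in> set w \<Longrightarrow> 0 < a"
  shows "\<exists>\<theta>::real. 0 \<le> \<theta> \<and> \<theta> < 1 \<and>
    (\<forall>E k s. E \<in> sets borel \<longrightarrow> 0 \<le> k \<longrightarrow>
       (\<forall>s. 0 \<le> s \<longrightarrow> s \<le> 1 \<longrightarrow> measure (mobius_measure s) E \<le> k) \<longrightarrow> 0 \<le> s \<longrightarrow> s \<le> 1 \<longrightarrow>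
       measure (mobius_measure s) {x. (gauss_map ^^ length w) x \<in> E} \<le> k \<and>
       measure (mobius_measure s) {x. (gauss_map ^^ length w) x \<in> E \<and> x \<notin> gauss_cylinder w} \<le> \<theta> * k)"
  using assms
proof (induction w)
  case Nil
  then show ?case by (intro exI[of _ 0]) auto
next
  case (Cons a w)
  obtain \<theta> :: real where \<theta>: "0 \<le> \<theta>" "\<theta> < 1"
    and IH: "\<And>E k s. E \<in> sets borel \<Longrightarrow> 0 \<le> k \<Longrightarrow>
       (\<And>s. 0 \<le> s \<Longrightarrow> s \<le> 1 \<Longrightarrow> measure (mobius_measure s) E \<le> k) \<Longrightarrow> 0 \<le> s \<Longrightarrow> s \<le> 1 \<Longrightarrow>
       measure (mobius_measure s) {x. (gauss_map ^^ length w) x \<in> E} \<le> k \<and>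
       measure (mobius_measure s) {x. (gauss_map ^^ length w) x \<in> E \<and> x \<notin> gauss_cylinder w} \<le> \<theta> * k"
    using Cons by auto
  have a: "0 < a" using Cons.prems by auto
  \<comment> \<open>Half the length of the cell of the digit \<open>a\<close>, hence a lower bound
    for its probability by \<open>mobius_measure_ge_lborel\<close>.\<close>
  define d where "d = 1 / (2 * real a * (real a + 1))"
  have d0: "0 < d" using a by (simp add: d_def)
  have d1: "d \<le> 1"
  proof -
    have "1 * 1 \<le> (2 * real a) * (real a + 1)" using a by (intro mult_mono) auto
    then show ?thesis by (simp add: d_def divide_le_eq_1)
  qed
  let ?D = "{x::real. 0 < x \<and> \<lfloor>1 / x\<rfloor> = int a}"
  have vim: "measure (mobius_measure s) {x. (\<forall>a. 0 < x \<and> \<lfloor>1 / x\<rfloor> = int a \<longrightarrow> a \<in> K) \<and> gauss_map x \<in> E}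
      \<le> measure (mobius_measure s) {x. \<forall>a. 0 < x \<and> \<lfloor>1 / x\<rfloor> = int a \<longrightarrow> a \<in> K} * k"
    if "E \<in> sets borel" "0 \<le> k" and le: "\<And>s. 0 \<le> s \<Longrightarrow> s \<le> 1 \<Longrightarrow> measure (mobius_measure s) E \<le> k"
      and s: "0 \<le> s" for E k s and K :: "nat set"
  proof -
    interpret prob_space "mobius_measure s" by (rule prob_space_mobius_measure) fact
    have "emeasure (mobius_measure u) E \<le> ennreal k" if "0 \<le> u" "u \<le> 1" for u
    proof -
      interpret U: prob_space "mobius_measure u" by (rule prob_space_mobius_measure) fact
      show ?thesis using le[OF that] \<open>0 \<le> k\<close> by (simp add: U.emeasure_eq_measure)
    qed
    from emeasure_gauss_vimage_le[OF s \<open>E \<in> sets borel\<close> this, of K] show ?thesis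
      using \<open>0 \<le> k\<close> by (simp add: emeasure_eq_measure flip: ennreal_mult)
  qed
  show ?case
  proof (intro exI[of _ "1 - d * (1 - \<theta>)"] conjI allI impI)
    show "0 \<le> 1 - d * (1 - \<theta>)" using d0 d1 \<theta> mult_mono[of d 1 "1 - \<theta>" 1] by simp
    show "1 - d * (1 - \<theta>) < 1" using d0 \<theta> by simp
    fix E :: "real set" and k s :: real
    assume [measurable]: "E \<in> sets borel" and k: "0 \<le> k"
      and le: "\<forall>s. 0 \<le> s \<longrightarrow> s \<le> 1 \<longrightarrow> measure (mobius_measure s) E \<le> k"
      and s: "0 \<le> s" "s \<le> 1"
    interpret prob_space "mobius_measure s" by (rule prob_space_mobius_measure) fact
    let ?E' = "{x. (gauss_map ^^ length w) x \<in> E}"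
    let ?F = "{x. (gauss_map ^^ length w) x \<in> E \<and> x \<notin> gauss_cylinder w}"
    have [measurable]: "(gauss_map ^^ length w) \<in> borel \<rightarrow>\<^sub>M borel"
      by (rule measurable_compose_n) simp
    have E'_le: "measure (mobius_measure u) ?E' \<le> k" and F_le: "measure (mobius_measure u) ?F \<le> \<theta> * k"
      if "0 \<le> u" "u \<le> 1" for u
      using IH[of E k u] k le that by auto
    have "prob {x. (gauss_map ^^ length (a # w)) x \<in> E} = prob {x. gauss_map x \<in> ?E'}"
      by (simp add: funpow_swap1)
    also have "\<dots> \<le> k"
      using vim[of ?E' k s UNIV] E'_le k s prob_space by simp
    finally show "prob {x. (gauss_map ^^ length (a # w)) x \<in> E} \<le> k" .
    \<comment> \<open>In \<open>?X\<close> the first digit is wrong; in \<open>?Y\<close> it is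
      \<open>a\<close>, but the tail misses \<open>w\<close>.\<close>
    let ?X = "{x. (\<forall>b. 0 < x \<and> \<lfloor>1 / x\<rfloor> = int b \<longrightarrow> b \<in> - {a}) \<and> gauss_map x \<in> ?E'}"
    let ?Y = "{x. 0 < x \<and> \<lfloor>1 / x\<rfloor> = int a \<and> gauss_map x \<in> ?F}"
    have "prob {x. (gauss_map ^^ length (a # w)) x \<in> E \<and> x \<notin> gauss_cylinder (a # w)} \<le> prob (?X \<union> ?Y)"
      by (intro finite_measure_mono) (auto simp: funpow_swap1)
    also have "\<dots> \<le> prob ?X + prob ?Y"
      by (intro measure_Un_le) measurable
    also have "prob ?X \<le> prob {x. \<forall>b. 0 < x \<and> \<lfloor>1 / x\<rfloor> = int b \<longrightarrow> b \<in> - {a}} * k"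
      using vim[of ?E' k s "- {a}"] E'_le k s by simp
    also have "{x. \<forall>b. 0 < x \<and> \<lfloor>1 / x\<rfloor> = int b \<longrightarrow> b \<in> - {a}} = space (mobius_measure s) - ?D"
      by auto
    also have "prob (space (mobius_measure s) - ?D) = 1 - prob ?D"
      by (intro prob_compl) simp
    also have "prob ?Y = prob ?D * measure (mobius_measure (1 / (a + s))) ?F"
      using gauss_digit_mobius[of s a ?F] s a by (simp add: measure_def enn2real_mult)
    also have "\<dots> \<le> prob ?D * (\<theta> * k)"
      using s a by (intro mult_left_mono F_le) auto
    also have "(1 - prob ?D) * k + prob ?D * (\<theta> * k) = (1 - prob ?D * (1 - \<theta>)) * k"
      by (simp add: algebra_simps)
    also have "\<dots> \<le> (1 - d * (1 - \<theta>)) * k"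
    proof -
      have "{1 / (real a + 1)<..1 / a} = ?D"
      proof (intro set_eqI iffI)
        fix x :: real assume x: "x \<in> {1 / (real a + 1)<..1 / a}"
        have "0 < 1 / (real a + 1)" by simp
        then have "0 < x" using x by (smt (verit) greaterThanAtMost_iff)
        then show "x \<in> ?D" using x a by (auto simp: floor_eq_iff field_simps)
      next
        fix x :: real assume "x \<in> ?D"
        then show "x \<in> {1 / (real a + 1)<..1 / a}" using a by (auto simp: floor_eq_iff field_simps)
      qed
      moreover have "{1 / (real a + 1)<..1 / a} \<subseteq> {0..1}"
      proof
        fix x assume x: "x \<in> {1 / (real a + 1)<..1 / a}"
        have "0 < 1 / (real a + 1)" "1 / a \<le> (1 :: real)" using a by auto
        then show "x \<in> {0..1}" using x by (smt (verit) atLeastAtMost_iff greaterThanAtMost_iff)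
      qed
      moreover have "emeasure lborel {1 / (real a + 1)<..1 / a} = ennreal (2 * d)"
      proof -
        have "1 / (real a + 1) \<le> 1 / a" using a by (simp add: frac_le)
        moreover have "1 / real a - 1 / (real a + 1) = 1 / (real a * (real a + 1))"
          using a by (simp add: field_simps)
        moreover have "2 * d = 1 / (real a * (real a + 1))" by (simp add: d_def mult.assoc)
        ultimately show ?thesis by (simp only: emeasure_lborel_Ioc)
      qed
      ultimately have "ennreal (2 * d) \<le> 2 * emeasure (mobius_measure s) ?D"
        using mobius_measure_ge_lborel[OF s, of ?D] by simp
      also have "\<dots> = ennreal (2 * prob ?D)"
        by (simp add: emeasure_eq_measure ennreal_mult)
      finally have "d \<le> prob ?D" by (simp add: ennreal_le_iff)
      then show ?thesis using \<theta> k by (intro mult_right_mono) auto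
    qed
    finally show "prob {x. (gauss_map ^^ length (a # w)) x \<in> E \<and> x \<notin> gauss_cylinder (a # w)}
      \<le> (1 - d * (1 - \<theta>)) * k" by simp
  qed
qed

text \<open>A point that never visits the cylinder lies outside it, and so does its whole future
  after \<open>length w\<close> steps; hence every uniform bound for the set \<open>E\<close> of
  such points improves by the factor \<theta>. Even length preserves the parity of the times. Parity
  matters later because odd iterates of the Gauss map reverse orientation.\<close>

lemma AE_gauss_visits_cylinder:
  assumes w: "\<And>a. a \<in> set w \<Longrightarrow> 0 < a" and "even (length w)"
  shows "AE x in lborel. 0 \<le> x \<and> x \<le> 1 \<longrightarrow> (\<exists>k. (gauss_map ^^ (2 * k)) x \<in> gauss_cylinder w)"
proof -
  define E where "E = {x. \<forall>k. (gauss_map ^^ (2 * k)) x \<notin> gauss_cylinder w}"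
  have [measurable]: "(gauss_map ^^ j) \<in> borel \<rightarrow>\<^sub>M borel" for j
    by (rule measurable_compose_n) simp
  have E[measurable]: "E \<in> sets borel" unfolding E_def by measurable
  obtain \<theta> :: real where \<theta>: "0 \<le> \<theta>" "\<theta> < 1"
    and le: "\<And>E k s. E \<in> sets borel \<Longrightarrow> 0 \<le> k \<Longrightarrow>
       (\<And>s. 0 \<le> s \<Longrightarrow> s \<le> 1 \<Longrightarrow> measure (mobius_measure s) E \<le> k) \<Longrightarrow> 0 \<le> s \<Longrightarrow> s \<le> 1 \<Longrightarrow>
       measure (mobius_measure s) {x. (gauss_map ^^ length w) x \<in> E \<and> x \<notin> gauss_cylinder w} \<le> \<theta> * k"
    using gauss_avoid_word[of w] w by auto
  have sub: "E \<subseteq> {x. (gauss_map ^^ length w) x \<in> E \<and> x \<notin> gauss_cylinder w}"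
  proof safe
    fix x assume x: "x \<in> E"
    then show False if "x \<in> gauss_cylinder w" using that by (auto simp: E_def dest: spec[of _ 0])
    obtain j where j: "length w = 2 * j" using assms(2) by (elim evenE)
    show "(gauss_map ^^ length w) x \<in> E"
      unfolding E_def
    proof safe
      fix k assume "(gauss_map ^^ (2 * k)) ((gauss_map ^^ length w) x) \<in> gauss_cylinder w"
      then have "(gauss_map ^^ (2 * (k + j))) x \<in> gauss_cylinder w"
        by (simp add: j funpow_add distrib_left)
      then show False using x unfolding E_def by blast
    qed
  qed
  \<comment> \<open>The bound is proved for all \<open>s\<close> at once, since \<open>le\<close>
    takes a bound uniform in \<open>s\<close>.\<close>
  have pow: "measure (mobius_measure s) E \<le> \<theta> ^ n" if "0 \<le> s" "s \<le> 1" for s n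
    using that
  proof (induction n arbitrary: s)
    case 0
    interpret prob_space "mobius_measure s" by (rule prob_space_mobius_measure) fact
    show ?case by simp
  next
    case (Suc n)
    interpret prob_space "mobius_measure s" by (rule prob_space_mobius_measure) fact
    have "prob E \<le> prob {x. (gauss_map ^^ length w) x \<in> E \<and> x \<notin> gauss_cylinder w}"
      using sub by (intro finite_measure_mono) auto
    also have "\<dots> \<le> \<theta> * \<theta> ^ n"
      using Suc \<theta> by (intro le) auto
    finally show ?case by simp
  qed
  interpret prob_space "mobius_measure 0" by (rule prob_space_mobius_measure) simp
  have "(\<lambda>n. \<theta> ^ n) \<longlonglongrightarrow> 0" using \<theta> by (intro LIMSEQ_power_zero) auto
  then have "prob E \<le> 0"
    by (rule LIMSEQ_le_const) (use pow[of 0] in auto)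
  then have "prob E = 0" by (simp add: measure_le_0_iff)
  then have "AE x in mobius_measure 0. x \<notin> E"
    by (intro AE_not_in) (auto simp: null_sets_def emeasure_eq_measure)
  then have "AE x in lborel. 0 \<le> x \<and> x \<le> 1 \<longrightarrow> x \<notin> E"
    by (intro AE_mobius_imp_AE_lborel[of 0]) auto
  then show ?thesis by (simp add: E_def)
qed

section \<open>Irrational Gauss orbits, diameters of cylinders and generic points\<close>

lemma gauss_map_nonneg: "0 \<le> gauss_map x"
  and gauss_map_lt_1: "gauss_map x < 1"
  by (auto simp: gauss_map_def frac_lt_1)

lemma gauss_map_irrational:
  assumes "x \<notin> \<rat>"
  shows "gauss_map x \<notin> \<rat>"
proof
  assume "gauss_map x \<in> \<rat>"
  then have "gauss_map x + of_int \<lfloor>1 / x\<rfloor> \<in> \<rat>" by (rule Rats_add) simp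
  then have "1 / x \<in> \<rat>" by (simp add: gauss_map_def frac_def)
  then have "inverse (1 / x) \<in> \<rat>" by (rule Rats_inverse)
  then show False using assms by simp
qed

lemma gauss_iterate_unit:
  assumes "x \<notin> \<rat>" "0 < x" "x < 1"
  shows "(gauss_map ^^ k) x \<notin> \<rat>" "0 < (gauss_map ^^ k) x" "(gauss_map ^^ k) x < 1"
proof -
  have *: "(gauss_map ^^ k) x \<notin> \<rat> \<and> 0 < (gauss_map ^^ k) x \<and> (gauss_map ^^ k) x < 1"
  proof (induction k)
    case (Suc k)
    then have "gauss_map ((gauss_map ^^ k) x) \<notin> \<rat>" by (intro gauss_map_irrational) auto
    moreover from this have "gauss_map ((gauss_map ^^ k) x) \<noteq> 0" by (metis Rats_0)
    ultimately show ?case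
      using gauss_map_nonneg gauss_map_lt_1 by (auto simp: less_le)
  qed (use assms in auto)
  then show "(gauss_map ^^ k) x \<notin> \<rat>" "0 < (gauss_map ^^ k) x" "(gauss_map ^^ k) x < 1" by auto
qed

fun gauss_word :: "nat \<Rightarrow> real \<Rightarrow> nat list" where
  "gauss_word 0 x = []"
| "gauss_word (Suc n) x = nat \<lfloor>1 / x\<rfloor> # gauss_word n (gauss_map x)"

lemma length_gauss_word [simp]: "length (gauss_word n x) = n"
  by (induction n arbitrary: x) auto

lemma gauss_word_irrational:
  assumes "x \<notin> \<rat>" "0 < x" "x < 1"
  shows "x \<in> gauss_cylinder (gauss_word n x)" "\<And>a. a \<in> set (gauss_word n x) \<Longrightarrow> 0 < a"
proof -
  have "x \<in> gauss_cylinder (gauss_word n x) \<and> (\<forall>a. a \<in> set (gauss_word n x) \<longrightarrow> 0 < a)"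
    using assms
  proof (induction n arbitrary: x)
    case (Suc n)
    have "1 \<le> \<lfloor>1 / x\<rfloor>" using Suc.prems by (simp add: le_floor_iff)
    then show ?case
      using Suc.IH[of "gauss_map x"] gauss_iterate_unit[OF Suc.prems, of 1] Suc.prems by auto
  qed simp
  then show "x \<in> gauss_cylinder (gauss_word n x)" "\<And>a. a \<in> set (gauss_word n x) \<Longrightarrow> 0 < a"
    by auto
qed

text \<open>With \<open>c\<close> the integer part of \<open>1 / x\<close>, the product equals
  \<open>1 - c * x \<le> 1 - x\<close>, and it is also at most \<open>x\<close>.\<close>

lemma gauss_step_product_le:
  assumes "0 < x" "x \<le> 1"
  shows "x * gauss_map x \<le> 1 / 2"
proof -
  have "x * gauss_map x \<le> x * 1"
    using assms gauss_map_lt_1[of x] by (intro mult_left_mono) auto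
  moreover have "x * gauss_map x = 1 - x * of_int \<lfloor>1 / x\<rfloor>"
    using assms by (simp add: gauss_map_def frac_def algebra_simps)
  moreover have "x * 1 \<le> x * of_int \<lfloor>1 / x\<rfloor>"
    using assms by (intro mult_left_mono) (auto simp: le_floor_iff)
  ultimately show ?thesis by linarith
qed

text \<open>For equal first digits, \<open>x - y\<close> is the difference of the images times
  \<open>- x * y\<close>. One step hardly contracts near 1, but by
  \<open>gauss_step_product_le\<close> two steps contract by at least the factor
  \<open>1 / 4\<close>.\<close>

lemma gauss_cylinder_diameter:
  assumes "x \<in> gauss_cylinder w" "y \<in> gauss_cylinder w" "2 * n \<le> length w"
    "0 \<le> x" "x \<le> 1" "0 \<le> y" "y \<le> 1"
  shows "\<bar>x - y\<bar> \<le> (1 / 4) ^ n"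
  using assms
proof (induction n arbitrary: w x y)
  case (Suc n)
  then obtain a b v where w: "w = a # b # v"
    by (cases w; cases "tl w") auto
  have step: "\<bar>x - y\<bar> = x * y * \<bar>gauss_map x - gauss_map y\<bar>"
    if "0 < x" "0 < y" "\<lfloor>1 / x\<rfloor> = \<lfloor>1 / y\<rfloor>" for x y
  proof -
    have "x * y * (gauss_map x - gauss_map y) = y - x"
      using that by (simp add: gauss_map_def frac_def field_simps)
    then have "\<bar>y - x\<bar> = \<bar>x * y\<bar> * \<bar>gauss_map x - gauss_map y\<bar>" by (metis abs_mult)
    then show ?thesis using that by (simp add: abs_minus_commute)
  qed
  let ?x = "gauss_map x" and ?y = "gauss_map y"
  have pos: "0 < x" "0 < y" "0 < ?x" "0 < ?y"
    and eq: "\<lfloor>1 / x\<rfloor> = \<lfloor>1 / y\<rfloor>" "\<lfloor>1 / ?x\<rfloor> = \<lfloor>1 / ?y\<rfloor>"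
    using Suc.prems by (auto simp: w)
  have "\<bar>x - y\<bar> = (x * ?x) * (y * ?y) * \<bar>gauss_map ?x - gauss_map ?y\<bar>"
    by (simp add: step[OF pos(1,2) eq(1)] step[OF pos(3,4) eq(2)])
  also have "\<dots> \<le> (1 / 2 * (1 / 2)) * (1 / 4) ^ n"
    using Suc.prems pos
    by (intro mult_mono gauss_step_product_le Suc.IH[of _ v])
       (auto simp: w gauss_map_nonneg intro: less_imp_le[OF gauss_map_lt_1])
  finally show ?case by simp
qed auto

text \<open>Smallness at time \<open>2 * k\<close>, used with \<open>r = \<alpha>\<close>, forces
  the \<alpha>-orbit to meet the Gauss orbit one step later, where the point has a prescribed
  position and the odd time gives orientation \<open>-1\<close>.\<close>

definition gauss_generic :: "real \<Rightarrow> bool" where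
  "gauss_generic x \<longleftrightarrow> x \<notin> \<rat> \<and> (\<forall>r p q. 0 < r \<longrightarrow> 0 \<le> p \<longrightarrow> p < q \<longrightarrow> q \<le> 1 \<longrightarrow>
     (\<exists>k. (gauss_map ^^ (2 * k)) x < r \<and> p < (gauss_map ^^ (2 * k + 1)) x \<and> (gauss_map ^^ (2 * k + 1)) x < q))"

lemma AE_lborel_irrational: "AE x::real in lborel. x \<notin> \<rat>"
  by (intro AE_not_in countable_imp_null_set_lborel countable_rat)

lemma ex_irrational_between:
  assumes "(p::real) < q"
  shows "\<exists>z. z \<notin> \<rat> \<and> p < z \<and> z < q"
proof (rule ccontr)
  assume "\<not> ?thesis"
  then have "{p<..<q} \<subseteq> \<rat>" by auto
  then have "countable {p<..<q}" using countable_rat countable_subset by blast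
  then show False using assms uncountable_open_interval by blast
qed

text \<open>There are only countably many words, so almost every point visits all cylinders of even
  length; each instance of genericity follows from one such visit.\<close>

lemma AE_gauss_generic: "AE x in lborel. 0 \<le> x \<and> x \<le> 1 \<longrightarrow> gauss_generic x"
proof -
  have "AE x in lborel. \<forall>w. (\<forall>a\<in>set w. 0 < a) \<and> even (length w) \<longrightarrow>
      0 \<le> x \<and> x \<le> 1 \<longrightarrow> (\<exists>k. (gauss_map ^^ (2 * k)) x \<in> gauss_cylinder w)"
    unfolding AE_all_countable using AE_gauss_visits_cylinder by (intro allI AE_impI) auto
  then show ?thesis using AE_lborel_irrational
  proof eventually_elim
    case (elim x)
    show ?case
      unfolding gauss_generic_def
    proof (intro impI conjI allI)
      fix r p q :: real
      assume x: "0 \<le> x \<and> x \<le> 1" and r: "0 < r" and pq: "0 \<le> p" "p < q" "q \<le> 1"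
      obtain z where z: "z \<notin> \<rat>" "p < z" "z < q" using ex_irrational_between[OF pq(2)] by blast
      have z01: "0 < z" "z < 1" using z pq by auto
      have "0 < min (z - p) (q - z)" using z by simp
      then obtain n where n: "(1 / 4) ^ n < min (z - p) (q - z)"
        using real_arch_pow_inv[of _ "1 / 4 :: real"] by (metis divide_less_eq_1_pos one_less_numeral_iff semiring_norm(76) zero_less_numeral)
      obtain N :: nat where N: "N \<noteq> 0" "inverse (real N) < r" using real_arch_inverse r by blast
      \<comment> \<open>The digit \<open>N\<close> forces the point at time \<open>2 * k\<close>
        below \<open>r\<close>; the digits of \<open>z\<close> force the next point within
        \<open>(1 / 4) ^ n\<close> of \<open>z\<close>. Their odd number makes the length of
        \<open>w\<close> even.\<close>
      define w where "w = N # gauss_word (2 * n + 1) z"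
      have "\<exists>k. (gauss_map ^^ (2 * k)) x \<in> gauss_cylinder w"
      proof -
        have "0 < a" if "a \<in> set w" for a
          using that gauss_word_irrational(2)[OF z(1) z01, of a "2 * n + 1"] N
          by (auto simp: w_def simp del: gauss_word.simps)
        moreover have "even (length w)" unfolding w_def by (simp del: gauss_word.simps)
        ultimately show ?thesis using elim(1) x by blast
      qed
      then obtain k where k: "(gauss_map ^^ (2 * k)) x \<in> gauss_cylinder w" by blast
      define t where "t = (gauss_map ^^ (2 * k)) x"
      have t: "0 < t" "\<lfloor>1 / t\<rfloor> = int N" "gauss_map t \<in> gauss_cylinder (gauss_word (2 * n + 1) z)"
        using k by (auto simp: w_def t_def)
      have "real N \<le> 1 / t" using t(2) by linarith
      then have "t \<le> inverse (real N)" using t(1) N by (simp add: field_simps)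
      moreover have "\<bar>gauss_map t - z\<bar> \<le> (1 / 4) ^ n"
        using gauss_word_irrational(1)[OF z(1) z01] t z01
        by (intro gauss_cylinder_diameter[of _ "gauss_word (2 * n + 1) z"])
           (auto simp: gauss_map_nonneg intro: less_imp_le[OF gauss_map_lt_1] simp del: gauss_word.simps)
      ultimately show "\<exists>k. (gauss_map ^^ (2 * k)) x < r \<and> p < (gauss_map ^^ (2 * k + 1)) x
          \<and> (gauss_map ^^ (2 * k + 1)) x < q"
        using n N by (intro exI[of _ k]) (auto simp: t_def)
    qed (use elim in auto)
  qed
qed

lemma AE_gauss_generic_frac: "AE x in lborel. gauss_generic (frac x)"
proof -
  have "AE x in lborel. 0 \<le> x - of_int n \<and> x - of_int n \<le> 1 \<longrightarrow> gauss_generic (x - of_int n)" for n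
  proof -
    obtain N where N: "N \<in> null_sets lborel" "{x. \<not> (0 \<le> x \<and> x \<le> 1 \<longrightarrow> gauss_generic x)} \<subseteq> N"
      using AE_gauss_generic by (auto simp: eventually_ae_filter)
    from N(1) have "AE x in lborel. x \<notin> {x. x - real_of_int n \<in> N}"
      by (intro AE_not_in null_sets_translation)
    then show ?thesis
    proof eventually_elim
      case (elim x)
      then show ?case using N(2) by blast
    qed
  qed
  then have "AE x in lborel. \<forall>n. 0 \<le> x - of_int n \<and> x - of_int n \<le> 1 \<longrightarrow> gauss_generic (x - of_int n)"
    unfolding AE_all_countable by blast
  then show ?thesis
  proof eventually_elim
    case (elim x)
    then show ?case
      using elim[rule_format, of "\<lfloor>x\<rfloor>"] frac_ge_0[of x] frac_lt_1[of x] unfolding frac_def by simp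
  qed
qed

section \<open>Comparison of the Gauss orbit with the orbit of the continued fraction map\<close>

text \<open>The sign of the derivative of the \<open>m\<close>-th iterate at \<open>x\<close>.\<close>

definition cf_orient :: "real \<Rightarrow> nat \<Rightarrow> real \<Rightarrow> real" where
  "cf_orient \<alpha> m x = (\<Prod>i<m. - sgn ((cf_map \<alpha> ^^ i) x))"

lemma cf_orient_simps [simp]:
  "cf_orient \<alpha> 0 x = 1"
  "cf_orient \<alpha> (Suc m) x = cf_orient \<alpha> m x * (- sgn ((cf_map \<alpha> ^^ m) x))"
  by (simp_all add: cf_orient_def)

lemma cf_map_diff_Ints: "x \<noteq> 0 \<Longrightarrow> cf_map \<alpha> x - 1 / \<bar>x\<bar> \<in> \<int>"
  by (simp add: cf_map_def)

lemma gauss_map_diff_Ints: "gauss_map x - 1 / x \<in> \<int>"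
  by (simp add: gauss_map_def frac_def)

lemma Ints_diff_trans: "x - y \<in> \<int> \<Longrightarrow> y - z \<in> \<int> \<Longrightarrow> x - z \<in> (\<int> :: real set)"
  using Ints_add[of "x - y" "y - z"] by simp

lemma Ints_diff_sym: "x - y \<in> \<int> \<Longrightarrow> y - x \<in> (\<int> :: real set)"
  using Ints_minus[of "x - y"] by simp

lemma Ints_diff_unit_cases:
  fixes y w :: real
  assumes "y - w \<in> \<int>" "-1 < y" "y < 1" "0 < w" "w < 1" "y \<noteq> 0"
  shows "y = w \<or> y = w - 1"
proof -
  obtain n where n: "y - w = of_int n" using assms(1) by (auto elim: Ints_cases)
  then have "-2 < n" "n < 1" using assms by linarith+
  then have "n = -1 \<or> n = 0" by linarith
  then show ?thesis using n by auto
qed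

lemma Ints_diff_eqI:
  fixes y w :: real
  assumes "y - w \<in> \<int>" "\<bar>y - w\<bar> < 1"
  shows "y = w"
  using assms by (metis Ints_nonzero_abs_less1 eq_iff_diff_eq_0)

lemma cf_map_irrational:
  assumes "x \<notin> \<rat>"
  shows "cf_map \<alpha> x \<notin> \<rat>"
proof
  assume "cf_map \<alpha> x \<in> \<rat>"
  moreover have "x \<noteq> 0" using assms by auto
  ultimately have "cf_map \<alpha> x + of_int \<lfloor>1 / \<bar>x\<bar> + 1 - \<alpha>\<rfloor> \<in> \<rat>" by (intro Rats_add Rats_of_int)
  then have "1 / \<bar>x\<bar> \<in> \<rat>" using \<open>x \<noteq> 0\<close> by (simp add: cf_map_def)
  then have "inverse (1 / \<bar>x\<bar>) \<in> \<rat>" by (rule Rats_inverse)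
  then show False using assms by (auto simp: abs_if split: if_splits)
qed

lemma cf_iterate_irrational: "x \<notin> \<rat> \<Longrightarrow> (cf_map \<alpha> ^^ m) x \<notin> \<rat>"
  by (induction m) (simp_all add: cf_map_irrational)

section \<open>Meeting times of the Gauss orbit and the \<alpha>-orbit\<close>

context
  fixes \<alpha> x :: real
  assumes \<alpha>: "0 < \<alpha>" "\<alpha> < 1" and x: "x \<in> cf_interval \<alpha>" "x \<notin> \<rat>"
begin

private abbreviation "y m \<equiv> (cf_map \<alpha> ^^ m) x"
private abbreviation "t k \<equiv> (gauss_map ^^ k) (frac x)"

text \<open>The Gauss orbit and the \<open>\<alpha>\<close>-orbit meet either before or after a common digit is read off;
  the second conjuncts compare the monotonicity of both iterates near \<open>x\<close>.\<close>

private definition "meets m k \<longleftrightarrow> y m - t k \<in> \<int> \<and> cf_orient \<alpha> m x = (-1) ^ k"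
private definition "meets_inv m k \<longleftrightarrow> 1 / \<bar>y m\<bar> - 1 / t k \<in> \<int> \<and> cf_orient \<alpha> m x * sgn (y m) = (-1) ^ k"

lemma cf_iterate_in_interval: "y m \<in> cf_interval \<alpha>"
  using x cf_map_in_cf_interval[OF \<alpha>] by (cases m) auto

private lemma y: "y m \<notin> \<rat>" "-1 < y m" "y m < \<alpha>" "y m < 1" "y m \<noteq> 0" "\<alpha> - 1 \<le> y m"
proof -
  show "y m \<notin> \<rat>" using x by (intro cf_iterate_irrational)
  then show "y m \<noteq> 0" by (metis Rats_0)
  show "-1 < y m" "y m < \<alpha>" "y m < 1" "\<alpha> - 1 \<le> y m"
    using cf_iterate_in_interval[of m] \<alpha> by (auto simp: cf_interval_def)
qed

private lemma t: "t k \<notin> \<rat>" "0 < t k" "t k < 1"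
proof -
  have "frac x \<notin> \<rat>"
  proof
    assume "frac x \<in> \<rat>"
    then have "frac x + of_int \<lfloor>x\<rfloor> \<in> \<rat>" by (intro Rats_add) auto
    then show False using x by (simp add: frac_def)
  qed
  moreover from this have "0 < frac x" using frac_ge_0[of x] by (metis Rats_0 order_le_less)
  ultimately show "t k \<notin> \<rat>" "0 < t k" "t k < 1"
    using gauss_iterate_unit[of "frac x" k] frac_lt_1[of x] by auto
qed

private lemma meets_0: "meets 0 0"
  by (simp add: meets_def frac_def)

private lemma meets_Suc:
  assumes "meets_inv m k"
  shows "meets (Suc m) (Suc k)"
proof -
  have "y (Suc m) - 1 / \<bar>y m\<bar> \<in> \<int>" using cf_map_diff_Ints y(5) by simp
  moreover have "1 / \<bar>y m\<bar> - 1 / t k \<in> \<int>" using assms by (simp add: meets_inv_def)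
  moreover have "1 / t k - t (Suc k) \<in> \<int>" using Ints_diff_sym[OF gauss_map_diff_Ints] by simp
  ultimately have "y (Suc m) - t (Suc k) \<in> \<int>" by (blast intro: Ints_diff_trans)
  then show ?thesis using assms by (simp add: meets_def meets_inv_def)
qed

text \<open>The only alternative to \<open>y m = t k\<close> is \<open>y m = t k - 1\<close>, which
  lies below \<open>\<alpha> - 1\<close>.\<close>

private lemma meets_inv_of_small:
  assumes "meets m k" "t k < \<alpha>"
  shows "meets_inv m k"
proof -
  have "y m = t k"
    using Ints_diff_unit_cases[of "y m" "t k"] assms y[of m] t[of k] by (auto simp: meets_def)
  then show ?thesis using assms t[of k] by (simp add: meets_def meets_inv_def)
qed

text \<open>The \<open>\<alpha>\<close>-orbit may replace the Gauss digit \<open>c\<close> by a chain of digits \<open>2\<close> with negative signs;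
  along the chain \<open>w\<close> runs through \<open>1 / (1 / t k - i)\<close>.\<close>

private lemma meets_inv_chain:
  assumes "y m - w \<in> \<int>" "0 < w" "w < 1" "1 / w - 1 / t k \<in> \<int>" "cf_orient \<alpha> m x = (-1) ^ k"
  shows "\<exists>m'. meets_inv m' k \<or> meets_inv m' (Suc k)"
  using assms
proof (induction "nat \<lfloor>1 / w\<rfloor>" arbitrary: m w rule: less_induct)
  case less
  have wirr: "w \<notin> \<rat>"
  proof
    assume "w \<in> \<rat>"
    moreover have "y m - w \<in> \<rat>" using less.prems(1) Ints_subset_Rats by blast
    ultimately have "y m - w + w \<in> \<rat>" by (intro Rats_add)
    then show False using y(1)[of m] by simp
  qed
  consider "y m = w" | "y m = w - 1" "w > 1 / 2" | "y m = w - 1" "w < 1 / 2"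
  proof -
    have "w \<noteq> 1 / 2" using wirr by (metis Rats_1 Rats_divide Rats_number_of)
    then show ?thesis
      using that Ints_diff_unit_cases[OF less.prems(1) y(2,4) less.prems(2,3) y(5)] by linarith
  qed
  then show ?case
  proof cases
    case 1
    then have "meets_inv m k" using less.prems by (simp add: meets_inv_def)
    then show ?thesis by blast
  next
    case 2
    \<comment> \<open>The reciprocals of \<open>w\<close> and \<open>t k\<close> have the same
      fractional part, which is \<open>1 / w - 1\<close> because \<open>w > 1 / 2\<close>. The
      negative sign of \<open>y m\<close> supplies the factor \<open>-1\<close> belonging to
      \<open>Suc k\<close>.\<close>
    have "t (Suc k) = 1 / w - 1"
    proof (rule Ints_diff_eqI)
      have "t (Suc k) - 1 / w \<in> \<int>"
        using gauss_map_diff_Ints[of "t k"] Ints_diff_sym[OF less.prems(4)]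
        by (auto intro: Ints_diff_trans)
      then have "t (Suc k) - 1 / w + 1 \<in> \<int>" by (intro Ints_add) auto
      then show "t (Suc k) - (1 / w - 1) \<in> \<int>" by (simp add: algebra_simps)
      have "0 < 1 / w - 1" "1 / w - 1 < 1" using 2 less.prems by (auto simp: field_simps)
      then show "\<bar>t (Suc k) - (1 / w - 1)\<bar> < 1" using t(2,3)[of "Suc k"] by linarith
    qed
    moreover have "1 / (1 - w) = 1 + 1 / (1 / w - 1)" using 2 less.prems by (simp add: field_simps)
    ultimately have "1 / \<bar>y m\<bar> - 1 / t (Suc k) = 1" using 2 less.prems by simp
    then have "meets_inv m (Suc k)" using 2 less.prems by (simp add: meets_inv_def)
    then show ?thesis by blast
  next
    case 3
    \<comment> \<open>A step with negative sign passes from \<open>w\<close> to \<open>v\<close>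
      modulo integers and keeps the orientation. The integer part of the reciprocal drops by one, so
      the recursion ends.\<close>
    define v where "v = w / (1 - w)"
    have v: "0 < v" "v < 1" "1 / v = 1 / w - 1" "1 / (1 - w) = 1 + v"
      using 3 less.prems by (auto simp: v_def field_simps)
    have "nat \<lfloor>1 / v\<rfloor> < nat \<lfloor>1 / w\<rfloor>"
    proof -
      have "1 \<le> \<lfloor>1 / w\<rfloor>" using less.prems by (simp add: le_floor_iff)
      moreover have "\<lfloor>1 / v\<rfloor> = \<lfloor>1 / w\<rfloor> - 1" unfolding v(3) by linarith
      ultimately show ?thesis by linarith
    qed
    moreover have "y (Suc m) - v \<in> \<int>"
    proof -
      have "y (Suc m) - (1 + v) \<in> \<int>"
        using cf_map_diff_Ints[OF y(5)[of m], of \<alpha>] 3 less.prems by (simp add: v(4))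
      then have "y (Suc m) - (1 + v) + 1 \<in> \<int>" by (intro Ints_add) auto
      then show ?thesis by simp
    qed
    moreover have "1 / v - 1 / t k \<in> \<int>"
    proof -
      have "1 / w - 1 / t k - 1 \<in> \<int>" by (rule Ints_diff[OF less.prems(4) Ints_1])
      then show ?thesis by (simp add: v(3) algebra_simps)
    qed
    moreover have "cf_orient \<alpha> (Suc m) x = (-1) ^ k" using 3 less.prems by simp
    ultimately show ?thesis using less.hyps v by blast
  qed
qed

private lemma meets_imp_meets_inv:
  assumes "meets m k"
  shows "\<exists>m'. meets_inv m' k \<or> meets_inv m' (Suc k)"
  using assms meets_inv_chain[of m "t k" k] t[of k] by (auto simp: meets_def)

text \<open>After a reciprocal meeting at \<open>k\<close> the orbits meet at \<open>Suc k\<close>,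
  and the chain then skips at most one Gauss time.\<close>

private lemma meets_inv_recurrent: "\<exists>m. meets_inv m k \<or> meets_inv m (Suc k)"
proof (induction k)
  case 0
  then show ?case using meets_imp_meets_inv[OF meets_0] .
next
  case (Suc k)
  then show ?case using meets_Suc meets_imp_meets_inv by blast
qed

text \<open>There is a reciprocal meeting at \<open>k\<close> or at \<open>k - 1\<close>. In the
  second case the orbits meet directly at \<open>k\<close>, and \<open>t k < \<alpha>\<close> turns
  this into a reciprocal meeting at \<open>k\<close>. For \<open>k = 0\<close> the direct meeting is
  the start itself.\<close>

lemma gauss_small_imp_cf_meets:
  assumes "t k < \<alpha>"
  shows "\<exists>m. y m - t (Suc k) \<in> \<int> \<and> cf_orient \<alpha> m x = (-1) ^ Suc k"
proof -
  have "\<exists>m. meets_inv m k"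
  proof (cases k)
    case 0
    then show ?thesis using meets_0 meets_inv_of_small assms by blast
  next
    case (Suc j)
    then show ?thesis
      using meets_inv_recurrent[of j] meets_Suc meets_inv_of_small assms by blast
  qed
  then show ?thesis using meets_Suc unfolding meets_def by blast
qed

end

section \<open>Points with common digits\<close>

text \<open>The odd-time Gauss point is placed just above \<alpha>, so the \<alpha>-orbit point
  congruent to it modulo 1 must be that point minus 1.\<close>

lemma gauss_generic_cf_visits:
  assumes \<alpha>: "0 < \<alpha>" "\<alpha> < 1" and x: "x \<in> cf_interval \<alpha>" "gauss_generic (frac x)" and "0 < \<delta>"
  shows "\<exists>m. \<alpha> - 1 < (cf_map \<alpha> ^^ m) x \<and> (cf_map \<alpha> ^^ m) x < \<alpha> - 1 + \<delta> \<and> cf_orient \<alpha> m x = -1"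
proof -
  have irr: "x \<notin> \<rat>"
  proof
    assume "x \<in> \<rat>"
    then have "frac x \<in> \<rat>" unfolding frac_def by (intro Rats_diff) auto
    then show False using x(2) by (simp add: gauss_generic_def)
  qed
  define q where "q = min 1 (\<alpha> + \<delta>)"
  obtain k where k: "(gauss_map ^^ (2 * k)) (frac x) < \<alpha>"
    "\<alpha> < (gauss_map ^^ Suc (2 * k)) (frac x)" "(gauss_map ^^ Suc (2 * k)) (frac x) < q"
    using x(2) \<alpha> \<open>0 < \<delta>\<close> unfolding gauss_generic_def q_def
    by (metis Suc_eq_plus1 less_add_same_cancel1 less_imp_le min.cobounded1 min_less_iff_conj)
  obtain m where m: "(cf_map \<alpha> ^^ m) x - (gauss_map ^^ Suc (2 * k)) (frac x) \<in> \<int>" "cf_orient \<alpha> m x = -1"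
    using gauss_small_imp_cf_meets[OF \<alpha> x(1) irr k(1)] by auto
  let ?y = "(cf_map \<alpha> ^^ m) x" and ?t = "(gauss_map ^^ Suc (2 * k)) (frac x)"
  have "?y \<in> cf_interval \<alpha>" by (rule cf_iterate_in_interval[OF \<alpha> x(1) irr])
  then have y: "\<alpha> - 1 \<le> ?y" "?y < \<alpha>" by (auto simp: cf_interval_def)
  moreover have "?y \<noteq> 0" using cf_iterate_irrational[OF irr, of m \<alpha>] by (metis Rats_0)
  moreover have "0 < ?t" "?t < 1" using k \<alpha> by (auto simp: q_def)
  ultimately have "?y = ?t - 1"
    using Ints_diff_unit_cases[OF m(1)] \<alpha> k by linarith
  then show ?thesis using k m(2) by (intro exI[of _ m]) (auto simp: q_def)
qed

section \<open>Digit sequences: monotonicity, contraction and local constancy\<close>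

lemma cf_process_eq_iff:
  "cf_process \<alpha> (Suc i) u = cf_process \<alpha> (Suc i) v \<longleftrightarrow>
     \<lfloor>1 / \<bar>(cf_map \<alpha> ^^ i) u\<bar> + 1 - \<alpha>\<rfloor> = \<lfloor>1 / \<bar>(cf_map \<alpha> ^^ i) v\<bar> + 1 - \<alpha>\<rfloor> \<and>
     sgn ((cf_map \<alpha> ^^ i) u) = sgn ((cf_map \<alpha> ^^ i) v)"
  by (simp add: cf_process_def cf_dig_def cf_eps_def)

text \<open>Positive \<open>i\<close> matters: \<open>n - 1\<close> truncates, so index 0 repeats
  index 1.\<close>

lemma cf_process_funpow: "0 < i \<Longrightarrow> cf_process \<alpha> (m + i) x = cf_process \<alpha> i ((cf_map \<alpha> ^^ m) x)"
  by (cases i) (simp_all add: cf_process_def cf_dig_def cf_eps_def funpow_add flip: funpow_swap1 add.commute)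

lemma cf_map_diff:
  assumes "sgn u = sgn v" "u \<noteq> 0" "\<lfloor>1 / \<bar>u\<bar> + 1 - \<alpha>\<rfloor> = \<lfloor>1 / \<bar>v\<bar> + 1 - \<alpha>\<rfloor>"
  shows "u * v > 0" "cf_map \<alpha> u - cf_map \<alpha> v = - sgn u * (u - v) / (u * v)"
proof -
  have "(0 < u \<and> 0 < v) \<or> (u < 0 \<and> v < 0)"
    using assms(1,2) by (auto simp: sgn_if split: if_splits)
  then have "u * v > 0 \<and> 1 / \<bar>u\<bar> - 1 / \<bar>v\<bar> = - sgn u * (u - v) / (u * v) \<and> v \<noteq> 0"
    by (elim disjE) (auto simp: mult_neg_neg divide_simps)
  then show "u * v > 0" "cf_map \<alpha> u - cf_map \<alpha> v = - sgn u * (u - v) / (u * v)"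
    using assms(2,3) by (auto simp: cf_map_def)
qed

text \<open>By \<open>cf_map_diff\<close> each step multiplies the difference by
  \<open>- sgn u / (u * v)\<close>, whose sign is the next factor of \<open>cf_orient\<close>. The
  product form covers both orientations and both orders of \<open>u\<close> and
  \<open>v\<close>.\<close>

lemma cf_iterate_monotone:
  assumes "u \<notin> \<rat>" "\<And>i. 1 \<le> i \<Longrightarrow> i \<le> m \<Longrightarrow> cf_process \<alpha> i u = cf_process \<alpha> i v"
  shows "0 \<le> cf_orient \<alpha> m u * (v - u) * ((cf_map \<alpha> ^^ m) v - (cf_map \<alpha> ^^ m) u)"
  using assms(2)
proof (induction m)
  case (Suc m)
  let ?u = "(cf_map \<alpha> ^^ m) u" and ?v = "(cf_map \<alpha> ^^ m) v"
  have IH: "0 \<le> cf_orient \<alpha> m u * (v - u) * (?v - ?u)" using Suc by simp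
  have u0: "?u \<noteq> 0" using cf_iterate_irrational[OF assms(1), of m \<alpha>] by (metis Rats_0)
  have "cf_process \<alpha> (Suc m) v = cf_process \<alpha> (Suc m) u" using Suc.prems[of "Suc m"] by simp
  then have eq: "sgn ?v = sgn ?u" "\<lfloor>1 / \<bar>?v\<bar> + 1 - \<alpha>\<rfloor> = \<lfloor>1 / \<bar>?u\<bar> + 1 - \<alpha>\<rfloor>"
    by (simp_all add: cf_process_eq_iff)
  have v0: "?v \<noteq> 0" using eq(1) u0 by (metis sgn_zero_iff)
  note d = cf_map_diff[OF eq(1) v0 eq(2)]
  have "cf_orient \<alpha> (Suc m) u * (v - u) * ((cf_map \<alpha> ^^ Suc m) v - (cf_map \<alpha> ^^ Suc m) u)
      = cf_orient \<alpha> m u * (v - u) * (?v - ?u) * (sgn ?u * sgn ?u) / (?v * ?u)"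
    by (simp add: d(2) eq(1))
  also have "sgn ?u * sgn ?u = 1" using u0 by (simp add: sgn_if)
  also have "0 \<le> cf_orient \<alpha> m u * (v - u) * (?v - ?u) * 1 / (?v * ?u)"
    using IH d(1) by (intro divide_nonneg_pos) auto
  finally show ?case .
qed simp

text \<open>Each common digit contracts the distance by
  \<open>\<bar>u\<bar> * \<bar>v\<bar> \<le> \<rho>^2 < 1\<close> along the orbits. Irrationality
  keeps the orbit of \<open>u\<close> off 0, and equal signs do the same for
  \<open>v\<close>.\<close>

lemma cf_process_separates:
  assumes \<alpha>: "0 < \<alpha>" "\<alpha> < 1" and u: "u \<in> cf_interval \<alpha>" "u \<notin> \<rat>" and v: "v \<in> cf_interval \<alpha>"
    and eq: "\<And>i. 0 < i \<Longrightarrow> cf_process \<alpha> i u = cf_process \<alpha> i v"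
  shows "u = v"
proof -
  define \<rho> where "\<rho> = max \<alpha> (1 - \<alpha>)"
  have \<rho>: "0 \<le> \<rho>" "\<rho> < 1" using \<alpha> by (auto simp: \<rho>_def)
  have le_\<rho>: "\<bar>z\<bar> \<le> \<rho>" if "z \<in> cf_interval \<alpha>" for z
    using that by (auto simp: \<rho>_def cf_interval_def)
  have iv: "(cf_map \<alpha> ^^ n) z \<in> cf_interval \<alpha>" if "z \<in> cf_interval \<alpha>" for n z
    using that cf_map_in_cf_interval[OF \<alpha>] by (cases n) auto
  have "\<bar>u - v\<bar> \<le> (\<rho> * \<rho>) ^ n * \<bar>(cf_map \<alpha> ^^ n) u - (cf_map \<alpha> ^^ n) v\<bar>" for n
  proof (induction n)
    case (Suc n)
    let ?u = "(cf_map \<alpha> ^^ n) u" and ?v = "(cf_map \<alpha> ^^ n) v"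
    have u0: "?u \<noteq> 0" using cf_iterate_irrational[OF u(2), of n \<alpha>] by (metis Rats_0)
    have "cf_process \<alpha> (Suc n) u = cf_process \<alpha> (Suc n) v" using eq by simp
    then have e: "sgn ?u = sgn ?v" "\<lfloor>1 / \<bar>?u\<bar> + 1 - \<alpha>\<rfloor> = \<lfloor>1 / \<bar>?v\<bar> + 1 - \<alpha>\<rfloor>"
      by (simp_all add: cf_process_eq_iff)
    note d = cf_map_diff[OF e(1) u0 e(2)]
    have "\<bar>?u - ?v\<bar> = (\<bar>?u\<bar> * \<bar>?v\<bar>) * \<bar>cf_map \<alpha> ?u - cf_map \<alpha> ?v\<bar>"
      using d(1) u0 e(1) unfolding d(2) by (auto simp: sgn_zero_iff abs_mult abs_sgn_eq)
    also have "\<dots> \<le> (\<rho> * \<rho>) * \<bar>cf_map \<alpha> ?u - cf_map \<alpha> ?v\<bar>"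
      using \<rho> iv u v by (intro mult_right_mono mult_mono le_\<rho>) auto
    finally have "(\<rho> * \<rho>) ^ n * \<bar>?u - ?v\<bar> \<le> (\<rho> * \<rho>) ^ n * ((\<rho> * \<rho>) * \<bar>cf_map \<alpha> ?u - cf_map \<alpha> ?v\<bar>)"
      using \<rho> by (intro mult_left_mono) auto
    then show ?case using Suc by (simp add: mult_ac)
  qed simp
  moreover have "(\<rho> * \<rho>) ^ n * \<bar>(cf_map \<alpha> ^^ n) u - (cf_map \<alpha> ^^ n) v\<bar> \<le> (\<rho> * \<rho>) ^ n * 2" for n
    using iv[OF u(1), of n] iv[OF v, of n] \<alpha> \<rho> by (intro mult_left_mono) (auto simp: cf_interval_def)
  ultimately have le: "\<bar>u - v\<bar> \<le> (\<rho> * \<rho>) ^ n * 2" for n by (meson order_trans)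
  have lim: "(\<lambda>n. (\<rho> * \<rho>) ^ n * 2) \<longlonglongrightarrow> 0 * 2"
    using \<rho> mult_left_le[of \<rho> \<rho>]
    by (intro tendsto_mult LIMSEQ_power_zero tendsto_const) (auto simp: abs_mult)
  have "\<bar>u - v\<bar> \<le> 0 * 2" using LIMSEQ_le_const[OF lim] le by blast
  then show ?thesis by simp
qed

text \<open>Away from 0 the digit jumps only where \<open>1 / \<bar>u\<bar> + 1 - \<alpha>\<close>
  is an integer, and such points are mapped to \<open>\<alpha> - 1\<close>.\<close>

lemma cf_map_locally_continuous:
  assumes "u \<noteq> 0" "cf_map \<alpha> u \<noteq> \<alpha> - 1"
  shows "isCont (cf_map \<alpha>) u"
    "eventually (\<lambda>v. \<lfloor>1 / \<bar>v\<bar> + 1 - \<alpha>\<rfloor> = \<lfloor>1 / \<bar>u\<bar> + 1 - \<alpha>\<rfloor> \<and> sgn v = sgn u) (nhds u)"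
proof -
  let ?f = "\<lambda>v::real. 1 / \<bar>v\<bar> + 1 - \<alpha>"
  have cont: "isCont ?f u" using assms(1) by (intro continuous_intros) auto
  have "of_int \<lfloor>?f u\<rfloor> < ?f u"
  proof -
    have "of_int \<lfloor>?f u\<rfloor> \<noteq> ?f u"
      using assms by (auto simp: cf_map_def)
    then show ?thesis by (smt (verit) of_int_floor_le)
  qed
  moreover have "?f u < of_int \<lfloor>?f u\<rfloor> + 1" by linarith
  ultimately have "eventually (\<lambda>v. of_int \<lfloor>?f u\<rfloor> < ?f v \<and> ?f v < of_int \<lfloor>?f u\<rfloor> + 1) (nhds u)"
  proof -
    assume *: "of_int \<lfloor>?f u\<rfloor> < ?f u" "?f u < of_int \<lfloor>?f u\<rfloor> + 1"
    have "filterlim ?f (nhds (?f u)) (nhds u)"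
      using cont tendsto_at_iff_tendsto_nhds[of ?f u] by (simp add: continuous_at)
    from order_tendstoD(1)[OF this *(1)] order_tendstoD(2)[OF this *(2)] show ?thesis
      by (rule eventually_conj)
  qed
  then have dig: "eventually (\<lambda>v. \<lfloor>?f v\<rfloor> = \<lfloor>?f u\<rfloor>) (nhds u)"
    by eventually_elim linarith
  have "eventually (\<lambda>v. sgn v = sgn u) (nhds u)"
  proof (cases "0 < u")
    case True
    then have "eventually (\<lambda>v. 0 < v) (nhds u)" by (rule eventually_nhds_in_open[OF open_greaterThan, simplified])
    then show ?thesis by eventually_elim (use True in simp)
  next
    case False
    then have "u < 0" using assms by simp
    then have "eventually (\<lambda>v. v < 0) (nhds u)" by (rule eventually_nhds_in_open[OF open_lessThan, simplified])
    then show ?thesis by eventually_elim (use \<open>u < 0\<close> in simp)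
  qed
  with dig show ev: "eventually (\<lambda>v. \<lfloor>?f v\<rfloor> = \<lfloor>?f u\<rfloor> \<and> sgn v = sgn u) (nhds u)"
    by eventually_elim simp
  have "isCont (\<lambda>v. 1 / \<bar>v\<bar> - of_int \<lfloor>?f u\<rfloor>) u" using assms(1) by (intro continuous_intros) auto
  moreover have "eventually (\<lambda>v. cf_map \<alpha> v = 1 / \<bar>v\<bar> - of_int \<lfloor>?f u\<rfloor>) (nhds u)"
    using ev
  proof eventually_elim
    case (elim v)
    then have "v \<noteq> 0" using assms(1) by (metis sgn_zero_iff)
    then show ?case using elim by (simp add: cf_map_def)
  qed
  ultimately show "isCont (cf_map \<alpha>) u" by (simp add: isCont_cong)
qed

text \<open>The digit with index \<open>Suc m\<close> is read off the iterate \<open>m\<close>, so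
  its constancy near \<open>u\<close> follows from continuity of that iterate. Only positive times
  are restricted, so that \<open>u = \<alpha> - 1\<close> is allowed.\<close>

lemma cf_process_locally_constant:
  assumes "u \<notin> \<rat>" "\<And>i. 0 < i \<Longrightarrow> (cf_map \<alpha> ^^ i) u \<noteq> \<alpha> - 1"
  shows "isCont (cf_map \<alpha> ^^ m) u \<and>
    eventually (\<lambda>v. \<forall>i. 0 < i \<and> i \<le> m \<longrightarrow> cf_process \<alpha> i v = cf_process \<alpha> i u) (nhds u)"
proof (induction m)
  case 0
  then show ?case by (simp add: id_def)
next
  case (Suc m)
  let ?u = "(cf_map \<alpha> ^^ m) u"
  have "?u \<noteq> 0" using cf_iterate_irrational[OF assms(1), of m \<alpha>] by (metis Rats_0)
  note loc = cf_map_locally_continuous[OF this assms(2)[of "Suc m", simplified]]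
  have IH: "isCont (cf_map \<alpha> ^^ m) u"
    "eventually (\<lambda>v. \<forall>i. 0 < i \<and> i \<le> m \<longrightarrow> cf_process \<alpha> i v = cf_process \<alpha> i u) (nhds u)"
    using Suc by auto
  have "isCont (cf_map \<alpha> \<circ> (cf_map \<alpha> ^^ m)) u"
    using IH(1) loc(1) by (rule continuous_at_compose)
  moreover have "filterlim (cf_map \<alpha> ^^ m) (nhds ?u) (nhds u)"
    using IH(1) unfolding continuous_at tendsto_at_iff_tendsto_nhds .
  then have "eventually (\<lambda>v. cf_process \<alpha> (Suc m) v = cf_process \<alpha> (Suc m) u) (nhds u)"
    unfolding cf_process_eq_iff using loc(2) by (rule eventually_compose_filterlim[rotated])
  with IH(2) have "eventually (\<lambda>v. \<forall>i. 0 < i \<and> i \<le> Suc m \<longrightarrow> cf_process \<alpha> i v = cf_process \<alpha> i u) (nhds u)"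
    by eventually_elim (auto simp: le_Suc_eq)
  ultimately show ?case by (simp add: o_def)
qed

section \<open>Failure of mixing\<close>

lemma gen_sigma_INT:
  assumes "finite J" "J \<subseteq> I" "\<And>j. j \<in> J \<Longrightarrow> S j \<in> sets N"
  shows "{x \<in> space P. \<forall>j\<in>J. X j x \<in> S j} \<in> gen_sigma P N X I"
proof -
  define \<G> where "\<G> = {X i -` S \<inter> space P | i S. i \<in> I \<and> S \<in> sets N}"
  have "\<G> \<subseteq> Pow (space P)" by (auto simp: \<G>_def)
  define M where "M = sigma (space P) \<G>"
  have M: "gen_sigma P N X I = sets M" "space M = space P"
    using \<open>\<G> \<subseteq> Pow (space P)\<close> by (simp_all add: M_def gen_sigma_def \<G>_def[symmetric])
  have "X j -` S j \<inter> space P \<in> gen_sigma P N X I" if "j \<in> J" for j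
    unfolding gen_sigma_def using that assms by (intro sigma_sets.Basic) blast
  then have "{x \<in> space M. X j x \<in> S j} \<in> sets M" if "j \<in> J" for j
    using that unfolding M by (simp add: vimage_def Int_def conj_commute)
  then have "{x \<in> space M. \<forall>j\<in>J. X j x \<in> S j} \<in> sets M"
    using assms(1) by (rule sets.sets_Collect_finite_All)
  then show ?thesis unfolding M .
qed

lemma gen_sigma_subset_sets:
  assumes "\<And>i. i \<in> I \<Longrightarrow> X i \<in> P \<rightarrow>\<^sub>M N"
  shows "gen_sigma P N X I \<subseteq> sets P"
  unfolding gen_sigma_def using assms by (intro sets.sigma_sets_subset) (auto intro: measurable_sets)

text \<open>A real supremum dominates its members only when the set is bounded above, so the bound 1
  is established for both suprema.\<close>

lemma (in prob_space) phi_coeff_ge: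
  assumes X: "\<And>i. 0 < i \<Longrightarrow> X i \<in> M \<rightarrow>\<^sub>M N" and "1 \<le> m"
    and A: "A \<in> gen_sigma M N X {1..m}" "0 < prob A" and B: "B \<in> gen_sigma M N X {m+n..}"
  shows "\<bar>prob (A \<inter> B) / prob A - prob B\<bar> \<le> phi_coeff M N X n"
proof -
  define \<A> where "\<A> k = gen_sigma M N X {1..k}" for k
  define \<B> where "\<B> k = gen_sigma M N X {k+n..}" for k
  have ev: "\<A> k \<subseteq> events" "\<B> k \<subseteq> events" if "1 \<le> k" for k
    unfolding \<A>_def \<B>_def using that by (intro gen_sigma_subset_sets X; auto)+
  have univ: "space M \<in> \<A> k" "space M \<in> \<B> k" for k
    using gen_sigma_INT[of "{}"] unfolding \<A>_def \<B>_def by auto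
  let ?S = "\<lambda>k. {\<bar>prob (A \<inter> B) / prob A - prob B\<bar> | A B. A \<in> \<A> k \<and> B \<in> \<B> k \<and> prob A > 0}"
  have le1: "x \<le> 1" if "x \<in> ?S k" "1 \<le> k" for x k
    using phi_dep_set_bounds(2)[OF ev[OF that(2)] that(1)] .
  have "\<bar>prob (A \<inter> B) / prob A - prob B\<bar> \<le> phi_dep M (\<A> m) (\<B> m)"
    unfolding phi_dep_def
  proof (rule cSup_upper)
    show "\<bar>prob (A \<inter> B) / prob A - prob B\<bar> \<in> ?S m" using A B by (auto simp: \<A>_def \<B>_def)
    show "bdd_above (?S m)" using le1 \<open>1 \<le> m\<close> by (intro bdd_aboveI[of _ 1]) blast
  qed
  also have "\<dots> \<le> phi_coeff M N X n"
    unfolding phi_coeff_def \<A>_def[symmetric] \<B>_def[symmetric]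
  proof (rule cSUP_upper)
    have "phi_dep M (\<A> k) (\<B> k) \<le> 1" if "1 \<le> k" for k
      unfolding phi_dep_def
    proof (rule cSup_least)
      show "?S k \<noteq> {}" using univ prob_space by (auto intro!: exI[of _ "space M"])
    qed (use le1 that in blast)
    then show "bdd_above ((\<lambda>k. phi_dep M (\<A> k) (\<B> k)) ` {1..})"
      by (intro bdd_aboveI[of _ 1]) auto
  qed (use \<open>1 \<le> m\<close> in auto)
  finally show ?thesis .
qed

section \<open>The invariant measure and the contradiction with mixing\<close>

context
  fixes \<alpha> :: real and \<mu> :: "real measure"
  assumes \<alpha>: "0 < \<alpha>" "\<alpha> < 1" and acip: "cf_acip \<alpha> \<mu>"
begin

lemma cf_acip_space: "space \<mu> = cf_interval \<alpha>"
proof -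
  have "sets \<mu> = sets (restrict_space lborel (cf_interval \<alpha>))" using acip by (simp add: cf_acip_def)
  from sets_eq_imp_space_eq[OF this] show ?thesis by (simp add: space_restrict_space)
qed

lemma cf_acip_AE: "AE x in lborel. P x \<Longrightarrow> AE x in \<mu>. P x"
proof (rule absolutely_continuous_AE)
  assume "AE x in lborel. P x"
  then show "AE x in restrict_space lborel (cf_interval \<alpha>). P x"
    by (subst AE_restrict_space_iff) (auto simp: cf_interval_def)
qed (use acip in \<open>auto simp: cf_acip_def\<close>)

lemma cf_iterate_measurable: "cf_map \<alpha> ^^ n \<in> \<mu> \<rightarrow>\<^sub>M \<mu>"
  using acip unfolding cf_acip_def by (blast intro: measurable_compose_n)

lemma cf_iterate_preserves:
  assumes "S \<in> sets \<mu>"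
  shows "measure \<mu> ((cf_map \<alpha> ^^ n) -` S \<inter> space \<mu>) = measure \<mu> S"
proof -
  have "distr \<mu> \<mu> (cf_map \<alpha> ^^ n) = \<mu>"
  proof (induction n)
    case 0
    then show ?case by (simp add: id_def distr_id)
  next
    case (Suc n)
    have "distr \<mu> \<mu> (cf_map \<alpha> ^^ Suc n) = distr (distr \<mu> \<mu> (cf_map \<alpha> ^^ n)) \<mu> (cf_map \<alpha>)"
      using acip cf_iterate_measurable[of n] by (subst distr_distr) (auto simp: cf_acip_def o_def)
    then show ?case using Suc acip by (simp add: cf_acip_def o_def)
  qed
  then show ?thesis using assms cf_iterate_measurable measure_distr by metis
qed

lemma cf_process_measurable: "cf_process \<alpha> n \<in> \<mu> \<rightarrow>\<^sub>M count_space UNIV \<Otimes>\<^sub>M borel"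
proof -
  have "(\<lambda>x. x) \<in> restrict_space borel (cf_interval \<alpha>) \<rightarrow>\<^sub>M borel"
    by (intro measurable_restrict_space1) simp
  moreover have "sets \<mu> = sets (restrict_space borel (cf_interval \<alpha>))"
    using acip by (simp add: cf_acip_def sets_restrict_space)
  ultimately have "(\<lambda>x. x) \<in> \<mu> \<rightarrow>\<^sub>M borel" using measurable_cong_sets by blast
  from measurable_compose[OF cf_iterate_measurable this]
  have [measurable]: "(\<lambda>x. (cf_map \<alpha> ^^ (n - 1)) x) \<in> \<mu> \<rightarrow>\<^sub>M borel" .
  show ?thesis
    unfolding cf_process_def[abs_def] cf_dig_def cf_eps_def by measurable
qed

lemma singleton_measurable_digit: "{w} \<in> sets (count_space (UNIV :: int set) \<Otimes>\<^sub>M (borel :: real measure))"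
proof -
  have "{fst w} \<times> {snd w} \<in> sets (count_space UNIV \<Otimes>\<^sub>M borel)" by (intro pair_measureI) auto
  also have "{fst w} \<times> {snd w} = {w}" by auto
  finally show ?thesis .
qed

text \<open>The choices are made in the order \<open>n\<close>, \<open>L\<close>, \<delta>,
  \<open>m\<close>: the gap, a block length making the prescribed digits improbable, a neighbourhood
  of the endpoint with constant digits, and a return into it.\<close>

lemma not_phi_mixing_of_generic:
  assumes gen: "gauss_generic (frac (\<alpha> - 1))"
  shows "\<not> cf_phi_mixing \<alpha> \<mu>"
proof
  assume mix: "cf_phi_mixing \<alpha> \<mu>"
  let ?N = "count_space (UNIV :: int set) \<Otimes>\<^sub>M (borel :: real measure)"
  interpret prob_space \<mu> using acip by (simp add: cf_acip_def)
  define p where "p = \<alpha> - 1"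
  define w where "w i = cf_process \<alpha> i p" for i
  have pI: "p \<in> cf_interval \<alpha>" using \<alpha> by (simp add: p_def cf_interval_def)
  have irr: "p \<notin> \<rat>"
  proof
    assume "p \<in> \<rat>"
    then have "frac p \<in> \<rat>" unfolding frac_def by (intro Rats_diff) auto
    then show False using gen by (simp add: gauss_generic_def p_def)
  qed
  have visits: "\<exists>m. p < (cf_map \<alpha> ^^ m) x \<and> (cf_map \<alpha> ^^ m) x < p + \<delta> \<and> cf_orient \<alpha> m x = -1"
    if "x \<in> cf_interval \<alpha>" "gauss_generic (frac x)" "0 < \<delta>" for x \<delta>
    unfolding p_def by (rule gauss_generic_cf_visits[OF \<alpha> that])
  have aperiodic: "(cf_map \<alpha> ^^ i) p \<noteq> \<alpha> - 1" if "0 < i" for i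
  proof
    assume "(cf_map \<alpha> ^^ i) p = \<alpha> - 1"
    then have per: "(cf_map \<alpha> ^^ (m mod i)) p = (cf_map \<alpha> ^^ m) p" for m
      by (intro funpow_mod_eq) (simp add: p_def)
    \<comment> \<open>A periodic orbit would have a least point above \<open>p\<close>,
      contradicting visits arbitrarily close to \<open>p\<close> from above.\<close>
    define S where "S = {s \<in> (\<lambda>j. (cf_map \<alpha> ^^ j) p) ` {..<i}. p < s}"
    have S: "(cf_map \<alpha> ^^ m) p \<in> S" if "p < (cf_map \<alpha> ^^ m) p" for m
      using that per[of m] \<open>0 < i\<close> unfolding S_def by (auto intro!: image_eqI[of _ _ "m mod i"])
    have "finite S" by (simp add: S_def)
    moreover have "S \<noteq> {}" using S visits[OF pI gen[folded p_def], of 1] by fastforce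
    ultimately have "Min S \<in> S" by (rule Min_in)
    then have "0 < Min S - p" by (simp add: S_def)
    from visits[OF pI gen[folded p_def] this] obtain m
      where "p < (cf_map \<alpha> ^^ m) p" "(cf_map \<alpha> ^^ m) p < Min S" by auto
    then show False using S \<open>finite S\<close> Min_le leD by blast
  qed
  have near: "\<exists>\<delta>>0. \<forall>x. \<bar>x - p\<bar> < \<delta> \<longrightarrow> (\<forall>i. 0 < i \<and> i \<le> m \<longrightarrow> cf_process \<alpha> i x = w i)" for m
    using cf_process_locally_constant[OF irr aperiodic, of m]
    by (auto simp: eventually_nhds_metric dist_real_def w_def)
  obtain n where n: "1 \<le> n" "phi_coeff \<mu> ?N (cf_process \<alpha>) n < 1 / 2"
  proof -
    have "eventually (\<lambda>n. phi_coeff \<mu> ?N (cf_process \<alpha>) n < 1 / 2) sequentially"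
      using mix unfolding cf_phi_mixing_def phi_mixing_def by (rule order_tendstoD(2)) simp
    with eventually_ge_at_top[of 1] have "eventually (\<lambda>n. 1 \<le> n \<and> phi_coeff \<mu> ?N (cf_process \<alpha>) n < 1 / 2) sequentially"
      by (rule eventually_conj)
    then show ?thesis using that by (auto dest: eventually_happens)
  qed
  define C where "C L = {x \<in> space \<mu>. \<forall>l\<le>L. cf_process \<alpha> (Suc l) x = w (n + l)}" for L
  have cyl: "{x \<in> space \<mu>. cf_process \<alpha> i x = v} \<in> events" for i v
    using measurable_sets[OF cf_process_measurable singleton_measurable_digit, of i v]
    by (simp add: vimage_def Int_def conj_commute)
  have C_ev: "C L \<in> events" for L
  proof -
    have "C L = {x \<in> space \<mu>. \<forall>l\<in>{..L}. cf_process \<alpha> (Suc l) x = w (n + l)}" by (auto simp: C_def)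
    also have "\<dots> \<in> events" by (rule sets.sets_Collect_finite_All[OF cyl finite_atMost])
    finally show ?thesis .
  qed
  obtain L where L: "prob (C L) < 1 / 2"
  proof -
    \<comment> \<open>The sequence \<open>w n, w (n + 1), ...\<close> is the digit sequence of
      \<open>q\<close>, so the decreasing events \<open>C L\<close> shrink to at most this point,
      which is null.\<close>
    define q where "q = (cf_map \<alpha> ^^ (n - 1)) p"
    have sub: "(\<Inter>L. C L) \<subseteq> {q}"
    proof
      fix x assume x: "x \<in> (\<Inter>L. C L)"
      have "q = x"
      proof (rule cf_process_separates[OF \<alpha>])
        show "q \<in> cf_interval \<alpha>" unfolding q_def by (rule cf_iterate_in_interval[OF \<alpha> pI irr])
        show "q \<notin> \<rat>" unfolding q_def by (rule cf_iterate_irrational[OF irr])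
        show "x \<in> cf_interval \<alpha>" using x by (auto simp: C_def cf_acip_space)
        fix i :: nat assume i: "0 < i"
        have "cf_process \<alpha> (Suc (i - 1)) x = w (n + (i - 1))" using x unfolding C_def by blast
        then have "cf_process \<alpha> i x = w (n + (i - 1))" using i by simp
        also have "n + (i - 1) = (n - 1) + i" using i n by simp
        also have "w ((n - 1) + i) = cf_process \<alpha> i q"
          unfolding w_def q_def using i by (rule cf_process_funpow)
        finally show "cf_process \<alpha> i q = cf_process \<alpha> i x" ..
      qed
      then show "x \<in> {q}" by simp
    qed
    have "AE x in \<mu>. x \<noteq> q" by (intro cf_acip_AE AE_lborel_singleton)
    then have "AE x in \<mu>. x \<notin> (\<Inter>L. C L)" by eventually_elim (use sub in blast)
    moreover have "(\<Inter>L. C L) \<in> events" using C_ev by blast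
    ultimately have "prob (\<Inter>L. C L) = 0" by (simp add: prob_eq_0)
    moreover have "(\<lambda>L. prob (C L)) \<longlonglongrightarrow> prob (\<Inter>L. C L)"
    proof (rule finite_Lim_measure_decseq)
      show "range C \<subseteq> events" using C_ev by blast
      have "C L' \<subseteq> C L" if "L \<le> L'" for L L'
        unfolding C_def using le_trans[OF _ that] by blast
      then show "decseq C" by (simp add: decseq_def)
    qed
    ultimately have "eventually (\<lambda>L. prob (C L) < 1 / 2) sequentially"
      by (intro order_tendstoD(2)[of _ "prob (\<Inter>L. C L)"]) auto
    then show ?thesis using that by (auto dest: eventually_happens)
  qed
  obtain \<delta> where \<delta>: "0 < \<delta>"
    and near_\<delta>: "\<And>x i. \<bar>x - p\<bar> < \<delta> \<Longrightarrow> 0 < i \<Longrightarrow> i \<le> n + L \<Longrightarrow> cf_process \<alpha> i x = w i"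
    using near[of "n + L"] by auto
  obtain m where m: "p < (cf_map \<alpha> ^^ m) p" "(cf_map \<alpha> ^^ m) p < p + \<delta>" "cf_orient \<alpha> m p = -1"
    using visits[OF pI gen[folded p_def] \<delta>] by blast
  have "m \<noteq> 0" using m(1) by (intro notI) simp
  define A where "A = {x \<in> space \<mu>. \<forall>i\<in>{1..m}. cf_process \<alpha> i x \<in> {w i}}"
  define B where "B = {x \<in> space \<mu>. \<forall>i\<in>{m+n..m+n+L}. cf_process \<alpha> i x \<in> {w (i - m)}}"
  have A_gen: "A \<in> gen_sigma \<mu> ?N (cf_process \<alpha>) {1..m}"
    unfolding A_def by (intro gen_sigma_INT singleton_measurable_digit) auto
  have B_gen: "B \<in> gen_sigma \<mu> ?N (cf_process \<alpha>) {m+n..}"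
    unfolding B_def by (intro gen_sigma_INT singleton_measurable_digit) auto
  have A_ev: "A \<in> events" using A_gen gen_sigma_subset_sets[of "{1..m}" "cf_process \<alpha>"] cf_process_measurable by blast
  have "A \<subseteq> B"
  proof
    fix x assume x: "x \<in> A"
    let ?y = "(cf_map \<alpha> ^^ m) x"
    have xI: "x \<in> space \<mu>" "p \<le> x" using x by (auto simp: A_def cf_acip_space cf_interval_def p_def)
    \<comment> \<open>As \<open>p\<close> is the left endpoint, \<open>p \<le> x\<close>; the
      reversed orientation then traps the image of \<open>x\<close> between \<open>p\<close> and the
      image of \<open>p\<close>.\<close>
    have "0 \<le> cf_orient \<alpha> m p * (x - p) * (?y - (cf_map \<alpha> ^^ m) p)"
      by (rule cf_iterate_monotone[OF irr]) (use x in \<open>auto simp: A_def w_def\<close>)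
    then have "?y \<le> (cf_map \<alpha> ^^ m) p"
      using m(3) xI(2) by (cases "x = p") (auto simp: zero_le_mult_iff)
    moreover have "p \<le> ?y"
      using xI(1) measurable_space[OF cf_iterate_measurable xI(1), of m]
      by (auto simp: cf_acip_space cf_interval_def p_def)
    ultimately have y: "\<bar>?y - p\<bar> < \<delta>" using m(2) by linarith
    have "cf_process \<alpha> i x = w (i - m)" if "i \<in> {m+n..m+n+L}" for i
    proof -
      have "cf_process \<alpha> (m + (i - m)) x = cf_process \<alpha> (i - m) ?y"
        using that n by (intro cf_process_funpow) auto
      also have "\<dots> = w (i - m)" using that n y by (intro near_\<delta>) auto
      finally show ?thesis using that by simp
    qed
    then show "x \<in> B" using xI by (simp add: B_def)
  qed
  then have AB: "A \<inter> B = A" by blast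
  have "prob B = prob (C L)"
  proof -
    \<comment> \<open>The shift is \<open>m + n - 1\<close> because digit indices start at 1;
      invariance of \<mu> then gives equal probabilities.\<close>
    have "B = (cf_map \<alpha> ^^ (m + n - 1)) -` C L \<inter> space \<mu>"
    proof (intro set_eqI iffI)
      fix x assume x: "x \<in> B"
      have "cf_process \<alpha> (Suc l) ((cf_map \<alpha> ^^ (m + n - 1)) x) = w (n + l)" if "l \<le> L" for l
        using x that n cf_process_funpow[of "Suc l" \<alpha> "m + n - 1" x]
        by (auto simp: B_def dest: bspec[of _ _ "m + n + l"])
      then show "x \<in> (cf_map \<alpha> ^^ (m + n - 1)) -` C L \<inter> space \<mu>"
        using x measurable_space[OF cf_iterate_measurable] by (auto simp: B_def C_def)
    next
      fix x assume x: "x \<in> (cf_map \<alpha> ^^ (m + n - 1)) -` C L \<inter> space \<mu>"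
      have "cf_process \<alpha> i x = w (i - m)" if "i \<in> {m+n..m+n+L}" for i
        using x that n cf_process_funpow[of "Suc (i - m - n)" \<alpha> "m + n - 1" x]
        by (auto simp: C_def dest: spec[of _ "i - m - n"])
      then show "x \<in> B" using x by (auto simp: B_def)
    qed
    then show ?thesis using cf_iterate_preserves[OF C_ev] by simp
  qed
  \<comment> \<open>Points just to the right of \<open>p\<close> lie in \<open>A\<close>. If
    \<open>A\<close> were null, so would be all its preimages, yet almost every orbit enters this
    neighbourhood.\<close>
  have "0 < prob A"
  proof (rule ccontr)
    assume "\<not> 0 < prob A"
    then have A0: "prob A = 0" using measure_nonneg[of \<mu> A] by linarith
    obtain \<eta> where \<eta>: "0 < \<eta>"
      and near_\<eta>: "\<And>x i. \<bar>x - p\<bar> < \<eta> \<Longrightarrow> 0 < i \<Longrightarrow> i \<le> m \<Longrightarrow> cf_process \<alpha> i x = w i"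
      using near[of m] by auto
    have "AE x in \<mu>. (cf_map \<alpha> ^^ j) x \<notin> A" for j
    proof -
      have "(cf_map \<alpha> ^^ j) -` A \<inter> space \<mu> \<in> events" using A_ev cf_iterate_measurable by (rule measurable_sets[rotated])
      then have "(cf_map \<alpha> ^^ j) -` A \<inter> space \<mu> \<in> null_sets \<mu>"
        using cf_iterate_preserves[OF A_ev, of j] A0 by (simp add: null_sets_def emeasure_eq_measure)
      from AE_not_in[OF this] AE_space show ?thesis by eventually_elim auto
    qed
    then have "AE x in \<mu>. \<forall>j. (cf_map \<alpha> ^^ j) x \<notin> A" by (simp add: AE_all_countable)
    moreover have "AE x in \<mu>. gauss_generic (frac x)" by (intro cf_acip_AE AE_gauss_generic_frac)
    ultimately have "AE x in \<mu>. False"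
      using AE_space
    proof eventually_elim
      case (elim x)
      obtain j where j: "p < (cf_map \<alpha> ^^ j) x" "(cf_map \<alpha> ^^ j) x < p + \<eta>"
        using visits[OF _ elim(2) \<eta>] elim(3) by (auto simp: cf_acip_space)
      have "(cf_map \<alpha> ^^ j) x \<in> A"
        using j near_\<eta> measurable_space[OF cf_iterate_measurable elim(3)] by (auto simp: A_def)
      then show ?case using elim(1) by blast
    qed
    then show False by simp
  qed
  \<comment> \<open>Since \<open>A \<subseteq> B\<close>, the conditional probability of
    \<open>B\<close> given \<open>A\<close> is 1.\<close>
  then have "1 - prob B \<le> phi_coeff \<mu> ?N (cf_process \<alpha>) n"
    using phi_coeff_ge[OF cf_process_measurable _ A_gen _ B_gen] \<open>m \<noteq> 0\<close> unfolding AB by simp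
  then show False using n(2) L \<open>prob B = prob (C L)\<close> by simp
qed

end

text \<open>The exceptional parameters lie in the null set where \<open>frac \<alpha>\<close> is not
  generic, a set independent of \<mu>.\<close>

theorem theorem6:
  shows "AE \<alpha> in lebesgue. 0 < \<alpha> \<and> \<alpha> < 1 \<longrightarrow> (\<forall>\<mu>. cf_acip \<alpha> \<mu> \<longrightarrow> \<not> cf_phi_mixing \<alpha> \<mu>)"
proof (rule AE_completion)
  show "AE \<alpha> in lborel. 0 < \<alpha> \<and> \<alpha> < 1 \<longrightarrow> (\<forall>\<mu>. cf_acip \<alpha> \<mu> \<longrightarrow> \<not> cf_phi_mixing \<alpha> \<mu>)"
    using AE_gauss_generic_frac
  proof eventually_elim
    case (elim \<alpha>)
    have "frac (\<alpha> - 1) = frac \<alpha>" using frac_1_eq[of "\<alpha> - 1"] by simp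
    then show ?case using not_phi_mixing_of_generic elim by auto
  qed
qed

end
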